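(* (i) Let $T\subset\mathbb{R}^d$ be compact, let $X=(X(t),\,t\in T)$ be a real-valued centered Gaussian random field on $T$ with continuous sample paths, and let $a\neq b$ be points of $T$ such that $T$ contains some path from $a$ to $b$. Set $$\Psi_{a,b}(u)=P\big(\exists\,\xi\in\mathcal{P}(a,b):\ \xi(v)\in T \text{ and } X(\xi(v))>u \text{ for all } 0\le v\le 1\big).$$ Then $$\lim_{u\to\infty}\frac{1}{u^2}\log\Psi_{a,b}(u)=-\frac12\, C_X(a,b),$$ where $$C_X(a,b)=\inf\big\{E H^2:\ H\in\mathcal{L},\ \text{and for some } \xi\in\mathcal{P}(a,b),\ \xi(v)\in T \text{ and } w_H(\xi(v))>1 \text{ for all } 0\le v\le 1\big\}.$$ (ii) Let $X=(X(t),\,t\in\mathbb{R}^d)$ be a real-valued centered stationary Gaussian random field with continuous sample paths, covariance function $R_X(t)=\mathrm{Cov}(X(0),X(t))$ and spectral measure $F_X$, and assume $\limsup_{\|t\|\to\infty}R_X(t)\le 0$. Let $a\in\mathbb{R}^d$, $a\ne 0$, and $\Psi_a(u)=P(\exists\,\xi\in\mathcal{P}(0,a):\ X(\xi(v))>u \text{ for all } 0\le v\le1)$. Then $$\lim_{u\to\infty}\frac{1}{u^2}\log\Psi_a(u)=-\frac12\,C_X(a),$$ where $$C_X(a)=\inf\Big\{\int_{\mathbb{R}^d}|h(x)|^2F_X(dx):\ h\in\mathcal{H}_F,\ \text{and for some }\xi\in\mathcal{P}(0,a),\ \int_{\mathbb{R}^d}e^{i(\xi(v),x)}\overline{h(x)}\,F_X(dx)>1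 \text{ for all } 0\le v\le 1\Big\}.$$
   Context: For $a,b\in\mathbb{R}^d$, $\mathcal{P}(a,b)$ is the set of paths from $a$ to $b$, i.e. continuous maps $\xi:[0,1]\to\mathbb{R}^d$ with $\xi(0)=a$, $\xi(1)=b$. For a field $X$ on a parameter set $T$, $\mathcal{L}$ denotes the closure in $L^2(P)$ of the set of finite linear combinations $\sum_j a_jX(t_j)$ ($a_j\in\mathbb{R}$, $t_j\in T$), and for $H\in\mathcal{L}$, $w_H(t)=E(X(t)H)$, $t\in T$. In the stationary case the spectral measure $F_X$ is the finite symmetric Borel measure on $\mathbb{R}^d$ with $R_X(t)=\int e^{i(t,x)}F_X(dx)$, and $\mathcal{H}_F$ denotes the set of functions $h\in L^2(F_X)$ (complex-valued) with even real part and odd imaginary part. The infimum of an empty set is $+\infty$ (so the limit is then $-\infty$). *)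

theory Defs
  imports "HOL-Probability.Probability"
begin

(* Outer probability P^*(A) = inf { P(B) : B measurable, A \<subseteq> B }.
   Used for the excursion probabilities, whose events need not be
   obviously measurable (they are universally measurable, so P^* agrees
   with the completed probability). *)
definition outer_prob :: "'a measure \<Rightarrow> 'a set \<Rightarrow> real" where
  "outer_prob M A = (INF B \<in> {B \<in> sets M. A \<subseteq> B}. measure M B)"

definition eln :: "real \<Rightarrow> ereal" where
  "eln x = (if 0 < x then ereal (ln x) else - \<infinity>)"

definition paths_from_to :: "'d::euclidean_space \<Rightarrow> 'd \<Rightarrow> (real \<Rightarrow> 'd) set" where
  "paths_from_to a b = {\<xi>. continuous_on {0..1} \<xi> \<and> \<xi> 0 = a \<and> \<xi> 1 = b}"

definition centered_normal_rv :: "'a measure \<Rightarrow> ('a \<Rightarrow> real) \<Rightarrow> bool" where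
  "centered_normal_rv M Y \<longleftrightarrow> Y \<in> borel_measurable M \<and>
     ((AE \<omega> in M. Y \<omega> = 0) \<or>
      (\<exists>\<sigma>>0. distributed M lborel Y (\<lambda>x. ennreal (normal_density 0 \<sigma> x))))"

definition lin_comb :: "('d \<Rightarrow> 'a \<Rightarrow> real) \<Rightarrow> 'd set \<Rightarrow> ('a \<Rightarrow> real) \<Rightarrow> bool" where
  "lin_comb X T Y \<longleftrightarrow> (\<exists>(n::nat) c t. (\<forall>i<n. t i \<in> T) \<and> Y = (\<lambda>\<omega>. \<Sum>i<n. c i * X (t i) \<omega>))"

definition centered_gaussian_field ::
    "'a measure \<Rightarrow> ('d \<Rightarrow> 'a \<Rightarrow> real) \<Rightarrow> 'd set \<Rightarrow> bool" where
  "centered_gaussian_field M X T \<longleftrightarrow>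
     (\<forall>t\<in>T. X t \<in> borel_measurable M) \<and>
     (\<forall>Y. lin_comb X T Y \<longrightarrow> centered_normal_rv M Y)"

definition continuous_paths :: "'a measure \<Rightarrow> ('d::topological_space \<Rightarrow> 'a \<Rightarrow> real) \<Rightarrow> 'd set \<Rightarrow> bool" where
  "continuous_paths M X T \<longleftrightarrow> (\<forall>\<omega>\<in>space M. continuous_on T (\<lambda>t. X t \<omega>))"

(* H \<in> \<L>: closure in L^2(P) of the finite linear combinations (H a representative) *)
definition in_L :: "'a measure \<Rightarrow> ('d \<Rightarrow> 'a \<Rightarrow> real) \<Rightarrow> 'd set \<Rightarrow> ('a \<Rightarrow> real) \<Rightarrow> bool" where
  "in_L M X T H \<longleftrightarrow> H \<in> borel_measurable M \<and> integrable M (\<lambda>\<omega>. (H \<omega>)\<^sup>2) \<and>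
     (\<exists>Y. (\<forall>n. lin_comb X T (Y n)) \<and>
          (\<lambda>n. integral\<^sup>L M (\<lambda>\<omega>. (Y n \<omega> - H \<omega>)\<^sup>2)) \<longlonglongrightarrow> 0)"

definition w_H :: "'a measure \<Rightarrow> ('d \<Rightarrow> 'a \<Rightarrow> real) \<Rightarrow> ('a \<Rightarrow> real) \<Rightarrow> 'd \<Rightarrow> real" where
  "w_H M X H t = integral\<^sup>L M (\<lambda>\<omega>. X t \<omega> * H \<omega>)"

definition Psi_ab :: "'a measure \<Rightarrow> ('d::euclidean_space \<Rightarrow> 'a \<Rightarrow> real) \<Rightarrow> 'd set \<Rightarrow> 'd \<Rightarrow> 'd \<Rightarrow> real \<Rightarrow> real" where
  "Psi_ab M X T a b u = outer_prob M {\<omega> \<in> space M. \<exists>\<xi>\<in>paths_from_to a b.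
       \<forall>v\<in>{0..1}. \<xi> v \<in> T \<and> X (\<xi> v) \<omega> > u}"

definition C_ab :: "'a measure \<Rightarrow> ('d::euclidean_space \<Rightarrow> 'a \<Rightarrow> real) \<Rightarrow> 'd set \<Rightarrow> 'd \<Rightarrow> 'd \<Rightarrow> ereal" where
  "C_ab M X T a b = Inf {ereal (integral\<^sup>L M (\<lambda>\<omega>. (H \<omega>)\<^sup>2)) | H. in_L M X T H \<and>
       (\<exists>\<xi>\<in>paths_from_to a b. \<forall>v\<in>{0..1}. \<xi> v \<in> T \<and> w_H M X H (\<xi> v) > 1)}"

definition cov_fun :: "'a measure \<Rightarrow> ('d::euclidean_space \<Rightarrow> 'a \<Rightarrow> real) \<Rightarrow> 'd \<Rightarrow> real" where
  "cov_fun M X t = integral\<^sup>L M (\<lambda>\<omega>. X 0 \<omega> * X t \<omega>)"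

definition stationary_cov :: "'a measure \<Rightarrow> ('d::euclidean_space \<Rightarrow> 'a \<Rightarrow> real) \<Rightarrow> bool" where
  "stationary_cov M X \<longleftrightarrow>
     (\<forall>s t. integral\<^sup>L M (\<lambda>\<omega>. X s \<omega> * X t \<omega>) = cov_fun M X (t - s))"

definition spectral_measure_of ::
    "'a measure \<Rightarrow> ('d::euclidean_space \<Rightarrow> 'a \<Rightarrow> real) \<Rightarrow> 'd measure \<Rightarrow> bool" where
  "spectral_measure_of M X F \<longleftrightarrow> sets F = sets borel \<and> finite_measure F \<and>
     (\<forall>A\<in>sets borel. emeasure F (uminus ` A) = emeasure F A) \<and>
     (\<forall>t. complex_of_real (cov_fun M X t) = integral\<^sup>L F (\<lambda>x. cis (t \<bullet> x)))"

definition H_F :: "'d::euclidean_space measure \<Rightarrow> ('d \<Rightarrow> complex) set" where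
  "H_F F = {h. h \<in> borel_measurable F \<and> integrable F (\<lambda>x. (cmod (h x))\<^sup>2) \<and>
     (\<forall>x. Re (h (- x)) = Re (h x)) \<and> (\<forall>x. Im (h (- x)) = - Im (h x))}"

definition Psi_a :: "'a measure \<Rightarrow> ('d::euclidean_space \<Rightarrow> 'a \<Rightarrow> real) \<Rightarrow> 'd \<Rightarrow> real \<Rightarrow> real" where
  "Psi_a M X a u = outer_prob M {\<omega> \<in> space M. \<exists>\<xi>\<in>paths_from_to 0 a.
       \<forall>v\<in>{0..1}. X (\<xi> v) \<omega> > u}"

(* C_X(a); "> 1" for a complex number read as: real and > 1 *)
definition C_a :: "'d::euclidean_space measure \<Rightarrow> 'd \<Rightarrow> ereal" where
  "C_a F a = Inf {ereal (integral\<^sup>L F (\<lambda>x. (cmod (h x))\<^sup>2)) | h. h \<in> H_F F \<and>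
       (\<exists>\<xi>\<in>paths_from_to 0 a. \<forall>v\<in>{0..1}.
          Im (integral\<^sup>L F (\<lambda>x. cis (\<xi> v \<bullet> x) * cnj (h x))) = 0 \<and>
          Re (integral\<^sup>L F (\<lambda>x. cis (\<xi> v \<bullet> x) * cnj (h x))) > 1)}"

end

theory Submission
  imports Defs "HOL-Real_Asymp.Real_Asymp"
begin

text \<open>For a set \<open>K\<close> of indices let \<open>v(K)\<close> (below: \<open>least_variance\<close>) be the infimum of the variances of
  the convex combinations of \<open>X(t)\<close>, \<open>t \<in> K\<close>. The first-order condition for near-minimisers, together with the Cauchy-Schwarz
  inequality, shows that \<open>1 / v(K)\<close> is the infimum of \<open>E H\<^sup>2\<close> over all \<open>H\<close> with \<open>w\<^sub>H > 1\<close> on \<open>K\<close>,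
  and also the infimum of the spectral norms in the stationary case. Hence the constant of the theorem
  is \<open>1 / sup v(K)\<close> over the path images \<open>K\<close>.

  Lower bound: if \<open>w\<^sub>H \<ge> 1\<close> on \<open>K\<close> and \<open>q = E H\<^sup>2\<close>, then \<open>X(t) = w\<^sub>H(t) H / q + Z(t)\<close> with \<open>Z\<close>
  independent of \<open>H\<close>, so \<open>X > u\<close> on \<open>K\<close> has at least about the probability of \<open>H > q u\<close>.

  Upper bound: Fernique's theorem, applied to the modulus of continuity of \<open>X\<close> at a small scale, shows
  that up to an event of negligible probability only finitely many representative sets \<open>K\<close> matter; on
  each of them a convex combination of variance about \<open>v(K)\<close> must exceed about \<open>u\<close>.

  In the stationary case a path that leaves a large ball passes through many points that are far
  apart, and the variance of the average of \<open>X\<close> over these points is small.\<close>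

section \<open>Real analysis\<close>

lemma tendsto_at_right_less_obtains:
  fixes f :: "real \<Rightarrow> real"
  assumes "(f \<longlongrightarrow> l) (at_right 0)" "l < k" "0 < e"
  obtains h where "f h < k" "0 < h" "h < e"
proof -
  have "\<forall>\<^sub>F h in at_right 0. f h < k \<and> h \<in> {0<..<e}"
    using assms by (intro eventually_conj order_tendstoD(2) eventually_at_right_real)
  then show thesis
    using that eventually_happens'[of "at_right (0::real)"] by auto
qed

lemma eventually_le_exp_quadratic:
  fixes k :: real
  assumes "0 < k"
  shows "\<forall>\<^sub>F u in at_top. C \<le> exp (k * u\<^sup>2 + b * u + d)"
proof -
  have "filterlim (\<lambda>u. exp (k * u\<^sup>2 + b * u + d)) at_top at_top"
    using assms by real_asymp
  then show ?thesis by (simp add: filterlim_at_top)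
qed

lemma power_two_bracket_obtains:
  fixes y :: real
  assumes "1 \<le> y"
  obtains n where "2 ^ n \<le> y" "y < 2 ^ Suc n"
proof -
  have "1 \<le> nat \<lfloor>y\<rfloor>" using assms by (simp add: le_nat_iff le_floor_iff)
  then obtain n where n: "2 ^ n \<le> nat \<lfloor>y\<rfloor>" "nat \<lfloor>y\<rfloor> < 2 ^ Suc n"
    using ex_power_ivl1[of 2 "nat \<lfloor>y\<rfloor>"] by auto
  have "2 ^ n \<le> y" using n(1) assms by (simp add: le_nat_iff le_floor_iff)
  moreover have "y < 2 ^ Suc n" using n(2) assms by (simp add: nat_less_iff floor_less_iff)
  ultimately show thesis by (rule that)
qed

section \<open>Square-integrable functions\<close>

definition square_integrable :: "'a measure \<Rightarrow> ('a \<Rightarrow> 'b::euclidean_space) \<Rightarrow> bool" where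
  "square_integrable M f \<longleftrightarrow> f \<in> borel_measurable M \<and> integrable M (\<lambda>x. (norm (f x))\<^sup>2)"

lemma square_integrable_real_iff:
  fixes f :: "'a \<Rightarrow> real"
  shows "square_integrable M f \<longleftrightarrow> f \<in> borel_measurable M \<and> integrable M (\<lambda>x. (f x)\<^sup>2)"
  by (simp add: square_integrable_def)

lemma square_integrable_measurable: "square_integrable M f \<Longrightarrow> f \<in> borel_measurable M"
  by (simp add: square_integrable_def)

lemma integrable_inner:
  assumes f: "square_integrable M f" and g: "square_integrable M g"
  shows "integrable M (\<lambda>x. f x \<bullet> g x)"
proof (rule Bochner_Integration.integrable_bound)
  note [measurable] = square_integrable_measurable[OF f] square_integrable_measurable[OF g]
  show "integrable M (\<lambda>x. (norm (f x))\<^sup>2 + (norm (g x))\<^sup>2)"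
    using assms by (simp add: square_integrable_def)
  show "(\<lambda>x. f x \<bullet> g x) \<in> borel_measurable M" by measurable
  have "\<bar>v \<bullet> w\<bar> \<le> (norm v)\<^sup>2 + (norm w)\<^sup>2" for v w :: 'b
    using Cauchy_Schwarz_ineq2[of v w] sum_squares_bound[of "norm v" "norm w"]
      mult_nonneg_nonneg[of "norm v" "norm w"] unfolding mult.assoc by simp
  then show "AE x in M. norm (f x \<bullet> g x) \<le> norm ((norm (f x))\<^sup>2 + (norm (g x))\<^sup>2)"
    by simp
qed

lemma square_integrable_zero: "square_integrable M (\<lambda>_. 0)"
  by (simp add: square_integrable_def)

lemma square_integrable_scaleR:
  assumes "square_integrable M f"
  shows "square_integrable M (\<lambda>x. c *\<^sub>R f x)"
  using assms by (simp add: square_integrable_def power_mult_distrib borel_measurable_scaleR)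

lemma square_integrable_add:
  assumes f: "square_integrable M f" and g: "square_integrable M g"
  shows "square_integrable M (\<lambda>x. f x + g x)"
proof -
  have "(norm (f x + g x))\<^sup>2 = (norm (f x))\<^sup>2 + 2 * (f x \<bullet> g x) + (norm (g x))\<^sup>2" for x
    by (simp add: power2_norm_eq_inner inner_add inner_commute)
  then show ?thesis
    using assms integrable_inner[OF f g] by (simp add: square_integrable_def borel_measurable_add)
qed

lemma square_integrable_sum_scaleR:
  assumes "\<And>i. i \<in> I \<Longrightarrow> square_integrable M (\<phi> i)"
  shows "square_integrable M (\<lambda>x. \<Sum>i\<in>I. c i *\<^sub>R \<phi> i x)"
  using assms
  by (induction I rule: infinite_finite_induct)
    (auto intro!: square_integrable_zero square_integrable_add square_integrable_scaleR)

lemma integral_norm_sum_square: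
  assumes \<phi>: "\<And>i. i \<in> I \<Longrightarrow> square_integrable M (\<phi> i)"
  shows "(\<integral>x. (norm (\<Sum>i\<in>I. c i *\<^sub>R \<phi> i x))\<^sup>2 \<partial>M) = (\<Sum>i\<in>I. \<Sum>j\<in>I. c i * c j * (\<integral>x. \<phi> i x \<bullet> \<phi> j x \<partial>M))"
proof -
  have "(norm (\<Sum>i\<in>I. c i *\<^sub>R \<phi> i x))\<^sup>2 = (\<Sum>i\<in>I. \<Sum>j\<in>I. c i * c j * (\<phi> i x \<bullet> \<phi> j x))" for x
    by (simp add: power2_norm_eq_inner inner_sum_left inner_sum_right sum_distrib_left inner_commute mult_ac)
  then show ?thesis
    using integrable_inner[OF \<phi> \<phi>] by (simp add: Bochner_Integration.integral_sum)
qed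

lemma Cauchy_Schwarz_integral:
  assumes f: "square_integrable M f" and g: "square_integrable M g"
  shows "(\<integral>x. f x \<bullet> g x \<partial>M)\<^sup>2 \<le> (\<integral>x. (norm (f x))\<^sup>2 \<partial>M) * (\<integral>x. (norm (g x))\<^sup>2 \<partial>M)"
    (is "?B\<^sup>2 \<le> ?A * ?C")
proof -
  have quadratic: "0 \<le> ?A - 2 * r * ?B + r\<^sup>2 * ?C" for r
  proof -
    have "0 \<le> (\<integral>x. (norm (f x - r *\<^sub>R g x))\<^sup>2 \<partial>M)" by simp
    also have "\<dots> = (\<integral>x. (norm (f x))\<^sup>2 - 2 * r * (f x \<bullet> g x) + r\<^sup>2 * (norm (g x))\<^sup>2 \<partial>M)"
      by (intro Bochner_Integration.integral_cong)
        (simp_all add: power2_norm_eq_inner inner_diff inner_commute power2_eq_square[of r])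
    also have "\<dots> = ?A - 2 * r * ?B + r\<^sup>2 * ?C"
      using integrable_inner[OF f g] f g by (simp add: square_integrable_def)
    finally show ?thesis .
  qed
  show ?thesis
  proof (cases "?C = 0")
    case True
    have "?B = 0"
    proof (rule ccontr)
      assume "?B \<noteq> 0"
      then show False using quadratic[of "(?A + 1) / (2 * ?B)"] True by simp
    qed
    then show ?thesis using True by simp
  next
    case False
    moreover have "0 \<le> ?C" by simp
    ultimately have "0 < ?C" by linarith
    then show ?thesis
      using quadratic[of "?B / ?C"] by (simp add: power2_eq_square field_simps)
  qed
qed

section \<open>Uniqueness of joint laws\<close>

lemma (in finite_measure) integrable_iexp:
  assumes "f \<in> borel_measurable M"
  shows "integrable M (\<lambda>x. iexp (f x))"
  using assms by (intro integrable_const_bound[where B = 1]) auto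

lemma (in finite_measure) prob_space_density_normalized:
  assumes "measure M (space M) = m" "0 < m"
  shows "prob_space (density M (\<lambda>_. ennreal (1 / m)))"
  using assms
  by (auto intro!: prob_spaceI simp: emeasure_density_const emeasure_eq_measure simp flip: ennreal_mult)

lemma emeasure_distr_density_const:
  assumes "V \<in> borel_measurable M" "A \<in> sets borel"
  shows "emeasure (distr (density M (\<lambda>_. c)) borel V) A = c * emeasure (distr M borel V) A"
  using assms by (simp add: emeasure_distr emeasure_density_const)

lemma distr_eqI_charfun:
  fixes V :: "'a \<Rightarrow> real" and W :: "'b \<Rightarrow> real"
  assumes "finite_measure M" "finite_measure N"
    and [measurable]: "V \<in> borel_measurable M" "W \<in> borel_measurable N"
    and charfun: "\<And>s. (\<integral>x. iexp (s * V x) \<partial>M) = (\<integral>x. iexp (s * W x) \<partial>N)"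
  shows "distr M borel V = distr N borel W"
proof -
  interpret M: finite_measure M by fact
  interpret N: finite_measure N by fact
  define m where "m = measure M (space M)"
  have "complex_of_real m = of_real (measure N (space N))"
    using charfun[of 0] by (simp add: m_def)
  then have mass_N: "measure N (space N) = m" by (simp only: of_real_eq_iff)
  show ?thesis
  proof (cases "m = 0")
    case True
    then have "measure M A = 0" "measure N B = 0" for A B
      using M.bounded_measure[of A] N.bounded_measure[of B] mass_N
      by (simp_all add: m_def measure_le_0_iff)
    then show ?thesis
      by (intro measure_eqI) (simp_all add: emeasure_distr M.emeasure_eq_measure N.emeasure_eq_measure)
  next
    case False
    then have m: "0 < m" by (simp add: m_def zero_less_measure_iff)
    define P where "P = density M (\<lambda>_. ennreal (1 / m))"
    define Q where "Q = density N (\<lambda>_. ennreal (1 / m))"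
    have [measurable]: "V \<in> borel_measurable P" "W \<in> borel_measurable Q"
      by (simp_all add: P_def Q_def)
    have "prob_space P" "prob_space Q"
      unfolding P_def Q_def using m mass_N m_def
      by (auto intro: M.prob_space_density_normalized N.prob_space_density_normalized)
    moreover have "char (distr P borel V) s = char (distr Q borel W) s" for s
      using m charfun[of s] unfolding char_def P_def Q_def
      by (simp add: integral_distr integral_density)
    ultimately have "distr P borel V = distr Q borel W"
      by (intro Levy_uniqueness prob_space.real_distribution_distr ext) auto
    then have "ennreal m * (ennreal (1 / m) * emeasure (distr M borel V) A) =
      ennreal m * (ennreal (1 / m) * emeasure (distr N borel W) A)" if "A \<in> sets borel" for A
      using that by (simp add: P_def Q_def flip: emeasure_distr_density_const)
    then show ?thesis
      using m by (intro measure_eqI) (simp_all add: mult.assoc[symmetric] flip: ennreal_mult)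
  qed
qed

lemma integral_weighted_indicator_eqI_charfun:
  fixes V f :: "'a \<Rightarrow> real" and W g :: "'b \<Rightarrow> real"
  assumes f: "integrable M f" "\<And>x. 0 \<le> f x" and g: "integrable N g" "\<And>x. 0 \<le> g x"
    and [measurable]: "V \<in> borel_measurable M" "W \<in> borel_measurable N"
    and charfun: "\<And>s. (\<integral>x. f x *\<^sub>R iexp (s * V x) \<partial>M) = (\<integral>x. g x *\<^sub>R iexp (s * W x) \<partial>N)"
    and [measurable]: "B \<in> sets borel"
  shows "(\<integral>x. f x * indicator B (V x) \<partial>M) = (\<integral>x. g x * indicator B (W x) \<partial>N)"
proof -
  note [measurable] = borel_measurable_integrable[OF f(1)] borel_measurable_integrable[OF g(1)]
  define P where "P = density M (\<lambda>x. ennreal (f x))"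
  define Q where "Q = density N (\<lambda>x. ennreal (g x))"
  have [measurable]: "V \<in> borel_measurable P" "W \<in> borel_measurable Q"
    by (simp_all add: P_def Q_def)
  have "finite_measure P" "finite_measure Q"
    unfolding P_def Q_def using f g
    by (auto intro!: finite_measureI simp: emeasure_density nn_integral_eq_integral cong: nn_integral_cong)
  moreover have "(\<integral>x. iexp (s * V x) \<partial>P) = (\<integral>x. iexp (s * W x) \<partial>Q)" for s
    using charfun[of s] f(2) g(2) by (simp add: P_def Q_def integral_density)
  ultimately have "distr P borel V = distr Q borel W"
    by (intro distr_eqI_charfun) auto
  moreover have "(\<integral>x. f x * indicator B (V x) \<partial>M) = (\<integral>y. indicator B y \<partial>distr P borel V)"
    using f(2) by (subst integral_distr) (auto simp: P_def integral_density)
  moreover have "(\<integral>x. g x * indicator B (W x) \<partial>N) = (\<integral>y. indicator B y \<partial>distr Q borel W)"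
    using g(2) by (subst integral_distr) (auto simp: Q_def integral_density)
  ultimately show ?thesis by simp
qed

text \<open>The weights \<open>1 + cos (S + c)\<close> are nonnegative and, by Euler's formula, combinations of the
  characters \<open>1\<close>, \<open>iexp S\<close> and \<open>iexp (- S)\<close>; so the one-dimensional uniqueness theorem applies.\<close>

lemma integral_cos_indicator_eqI_charfun:
  fixes V S :: "'a \<Rightarrow> real" and W R :: "'b \<Rightarrow> real"
  assumes "finite_measure M" "finite_measure N"
    and [measurable]: "V \<in> borel_measurable M" "S \<in> borel_measurable M"
      "W \<in> borel_measurable N" "R \<in> borel_measurable N"
    and charfun: "\<And>s r. (\<integral>x. iexp (s * V x + r * S x) \<partial>M) = (\<integral>x. iexp (s * W x + r * R x) \<partial>N)"
    and [measurable]: "B \<in> sets borel"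
  shows "(\<integral>x. cos (S x + c) * indicator B (V x) \<partial>M) = (\<integral>x. cos (R x + c) * indicator B (W x) \<partial>N)"
proof -
  interpret M: finite_measure M by fact
  interpret N: finite_measure N by fact
  have euler: "(1 + cos (r + c)) *\<^sub>R iexp v =
      iexp v + iexp c / 2 * iexp (v + r) + iexp (- c) / 2 * iexp (v - r)" for r v :: real
    by (simp add: scaleR_conv_of_real cos_exp_eq cos_of_real[symmetric] distrib_left distrib_right
        exp_add right_diff_distrib exp_diff exp_minus field_simps)
  have "(\<integral>x. (1 + cos (S x + c)) *\<^sub>R iexp (s * V x) \<partial>M) =
      (\<integral>x. (1 + cos (R x + c)) *\<^sub>R iexp (s * W x) \<partial>N)" for s
    unfolding euler
    using charfun[of s 0] charfun[of s 1] charfun[of s "-1"]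
    by (simp add: M.integrable_iexp N.integrable_iexp del: of_real_add of_real_diff of_real_mult)
  moreover have "0 \<le> 1 + cos y" "1 + cos y \<le> 2" for y :: real
    using cos_ge_minus_one[of y] cos_le_one[of y] by linarith+
  ultimately have weighted: "(\<integral>x. (1 + cos (S x + c)) * indicator B (V x) \<partial>M) =
      (\<integral>x. (1 + cos (R x + c)) * indicator B (W x) \<partial>N)"
    by (intro integral_weighted_indicator_eqI_charfun M.integrable_const_bound[where B = 2]
        N.integrable_const_bound[where B = 2] AE_I2) simp_all
  have unweighted: "(\<integral>x. 1 * indicat_real B (V x) \<partial>M) = (\<integral>x. 1 * indicat_real B (W x) \<partial>N)"
    using charfun[of _ 0]
    by (intro integral_weighted_indicator_eqI_charfun) (simp_all del: of_real_mult)
  have "integrable M (\<lambda>x. indicator B (V x) :: real)" "integrable N (\<lambda>x. indicator B (W x) :: real)"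
    "integrable M (\<lambda>x. cos (S x + c) * indicator B (V x))"
    "integrable N (\<lambda>x. cos (R x + c) * indicator B (W x))"
    by (auto intro!: M.integrable_const_bound[where B = 1] N.integrable_const_bound[where B = 1]
        simp: indicator_def abs_mult)
  then show ?thesis
    using weighted unweighted by (simp add: distrib_right)
qed

lemma integral_indicator_iexp_eqI_charfun:
  fixes V S :: "'a \<Rightarrow> real" and W R :: "'b \<Rightarrow> real"
  assumes "finite_measure M" "finite_measure N"
    and [measurable]: "V \<in> borel_measurable M" "S \<in> borel_measurable M"
      "W \<in> borel_measurable N" "R \<in> borel_measurable N"
    and "\<And>s r. (\<integral>x. iexp (s * V x + r * S x) \<partial>M) = (\<integral>x. iexp (s * W x + r * R x) \<partial>N)"
    and [measurable]: "B \<in> sets borel"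
  shows "(\<integral>x. indicator B (V x) *\<^sub>R iexp (S x) \<partial>M) = (\<integral>x. indicator B (W x) *\<^sub>R iexp (R x) \<partial>N)"
proof -
  interpret M: finite_measure M by fact
  interpret N: finite_measure N by fact
  have int: "integrable M (\<lambda>x. indicator B (V x) *\<^sub>R iexp (S x))"
    "integrable N (\<lambda>x. indicator B (W x) *\<^sub>R iexp (R x))"
    by (auto intro!: M.integrable_const_bound[where B = 1] N.integrable_const_bound[where B = 1]
        simp: indicator_def)
  note cos_eq = integral_cos_indicator_eqI_charfun[OF assms]
  have sin_cos: "sin y = cos (y + (- pi / 2))" for y :: real
    by (simp add: cos_diff)
  show ?thesis
  proof (rule complex_eqI)
    show "Re (\<integral>x. indicator B (V x) *\<^sub>R iexp (S x) \<partial>M) = Re (\<integral>x. indicator B (W x) *\<^sub>R iexp (R x) \<partial>N)"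
      using cos_eq[of 0]
      by (simp add: integral_Re[OF int(1), symmetric] integral_Re[OF int(2), symmetric] Re_exp mult.commute)
    show "Im (\<integral>x. indicator B (V x) *\<^sub>R iexp (S x) \<partial>M) = Im (\<integral>x. indicator B (W x) *\<^sub>R iexp (R x) \<partial>N)"
      using cos_eq[of "- pi / 2"]
      by (simp add: integral_Im[OF int(1), symmetric] integral_Im[OF int(2), symmetric] Im_exp sin_cos
            mult.commute)
  qed
qed

lemma integral_density_indicator:
  fixes f :: "'a \<Rightarrow> 'b::{banach,second_countable_topology}"
  assumes "A \<in> sets M" "f \<in> borel_measurable M"
  shows "(\<integral>x. f x \<partial>density M (indicator A)) = (\<integral>x. indicator A x *\<^sub>R f x \<partial>M)"
proof -
  have "density M (indicator A) = density M (\<lambda>x. ennreal (indicator A x))"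
    by (simp add: ennreal_indicator)
  then show ?thesis using assms by (simp add: integral_density)
qed

lemma sum_insert_scaled:
  fixes \<theta> Z :: "'i \<Rightarrow> real"
  assumes "finite I" "j \<notin> I"
  shows "(\<Sum>i\<in>insert j I. (if i = j then s else r * \<theta> i) * Z i) = s * Z j + r * (\<Sum>i\<in>I. \<theta> i * Z i)"
proof -
  have "(\<Sum>i\<in>I. (if i = j then s else r * \<theta> i) * Z i) = (\<Sum>i\<in>I. r * (\<theta> i * Z i))"
    using assms(2) by (intro sum.cong) auto
  then show ?thesis using assms by (simp add: sum_distrib_left)
qed

lemma measure_box_eqI_charfun:
  fixes V :: "'i \<Rightarrow> 'a \<Rightarrow> real" and W :: "'i \<Rightarrow> 'b \<Rightarrow> real"
  assumes "finite I" "finite_measure M" "finite_measure N"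
    and "\<And>i. i \<in> I \<Longrightarrow> V i \<in> borel_measurable M" "\<And>i. i \<in> I \<Longrightarrow> W i \<in> borel_measurable N"
    and "\<And>\<theta>. (\<integral>x. iexp (\<Sum>i\<in>I. \<theta> i * V i x) \<partial>M) = (\<integral>x. iexp (\<Sum>i\<in>I. \<theta> i * W i x) \<partial>N)"
    and "\<And>i. i \<in> I \<Longrightarrow> B i \<in> sets borel"
  shows "measure M {x\<in>space M. \<forall>i\<in>I. V i x \<in> B i} = measure N {x\<in>space N. \<forall>i\<in>I. W i x \<in> B i}"
  using assms
proof (induction I arbitrary: M N rule: finite_induct)
  case empty
  have "complex_of_real (measure M (space M)) = of_real (measure N (space N))"
    using empty.prems(5)[of "\<lambda>_. 0"] by simp
  then show ?case by (simp only: of_real_eq_iff) simp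
next
  case (insert j I)
  have [measurable]: "V j \<in> borel_measurable M" "W j \<in> borel_measurable N" "B j \<in> sets borel"
    and [measurable]: "\<And>i. i \<in> I \<Longrightarrow> V i \<in> borel_measurable M" "\<And>i. i \<in> I \<Longrightarrow> W i \<in> borel_measurable N"
      "\<And>i. i \<in> I \<Longrightarrow> B i \<in> sets borel"
    using insert.prems by auto
  let ?S = "\<lambda>\<theta> x. \<Sum>i\<in>I. \<theta> i * V i x" and ?R = "\<lambda>\<theta> x. \<Sum>i\<in>I. \<theta> i * W i x"
  define M' where "M' = density M (indicator {x\<in>space M. V j x \<in> B j})"
  define N' where "N' = density N (indicator {x\<in>space N. W j x \<in> B j})"
  have "measure M' {x\<in>space M'. \<forall>i\<in>I. V i x \<in> B i} = measure N' {x\<in>space N'. \<forall>i\<in>I. W i x \<in> B i}"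
  proof (rule insert.IH)
    show "finite_measure M'" "finite_measure N'"
      unfolding M'_def N'_def using insert.prems(1,2)
      by (auto intro!: finite_measure.finite_measure_restricted)
    fix \<theta>
    have "(\<integral>x. iexp (s * V j x + r * ?S \<theta> x) \<partial>M) = (\<integral>x. iexp (s * W j x + r * ?R \<theta> x) \<partial>N)" for s r
      using insert.prems(5)[of "\<lambda>i. if i = j then s else r * \<theta> i"]
      by (simp only: sum_insert_scaled[OF insert.hyps(1,2)])
    then have "(\<integral>x. indicator (B j) (V j x) *\<^sub>R iexp (?S \<theta> x) \<partial>M) =
        (\<integral>x. indicator (B j) (W j x) *\<^sub>R iexp (?R \<theta> x) \<partial>N)"
      using insert.prems(1,2) by (intro integral_indicator_iexp_eqI_charfun) auto
    moreover have "(\<integral>x. iexp (?S \<theta> x) \<partial>M') = (\<integral>x. indicator (B j) (V j x) *\<^sub>R iexp (?S \<theta> x) \<partial>M)"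
      "(\<integral>x. iexp (?R \<theta> x) \<partial>N') = (\<integral>x. indicator (B j) (W j x) *\<^sub>R iexp (?R \<theta> x) \<partial>N)"
      unfolding M'_def N'_def
      by (subst integral_density_indicator;
        auto intro!: Bochner_Integration.integral_cong simp: indicator_def simp del: of_real_sum)+
    ultimately show "(\<integral>x. iexp (?S \<theta> x) \<partial>M') = (\<integral>x. iexp (?R \<theta> x) \<partial>N')" by simp
  qed (auto simp: M'_def N'_def)
  moreover have "measure M' {x\<in>space M'. \<forall>i\<in>I. V i x \<in> B i} =
      measure M {x\<in>space M. \<forall>i\<in>insert j I. V i x \<in> B i}"
    using insert.hyps unfolding M'_def
    by (subst measure_restricted) (auto intro!: arg_cong[where f = "measure M"])
  moreover have "measure N' {x\<in>space N'. \<forall>i\<in>I. W i x \<in> B i} =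
      measure N {x\<in>space N. \<forall>i\<in>insert j I. W i x \<in> B i}"
    using insert.hyps unfolding N'_def
    by (subst measure_restricted) (auto intro!: arg_cong[where f = "measure N"])
  ultimately show ?case by simp
qed

theorem distr_PiM_eqI_charfun:
  fixes V :: "'i \<Rightarrow> 'a \<Rightarrow> real" and W :: "'i \<Rightarrow> 'b \<Rightarrow> real"
  assumes M: "finite_measure M" and N: "finite_measure N"
    and V[measurable]: "\<And>i. i \<in> I \<Longrightarrow> V i \<in> borel_measurable M"
    and W[measurable]: "\<And>i. i \<in> I \<Longrightarrow> W i \<in> borel_measurable N"
    and charfun: "\<And>J \<theta>. finite J \<Longrightarrow> J \<subseteq> I \<Longrightarrow>
      (\<integral>x. iexp (\<Sum>i\<in>J. \<theta> i * V i x) \<partial>M) = (\<integral>x. iexp (\<Sum>i\<in>J. \<theta> i * W i x) \<partial>N)"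
  shows "distr M (\<Pi>\<^sub>M i\<in>I. borel) (\<lambda>x. \<lambda>i\<in>I. V i x) = distr N (\<Pi>\<^sub>M i\<in>I. borel) (\<lambda>x. \<lambda>i\<in>I. W i x)"
proof (rule measure_eqI_PiM_infinite)
  interpret M: finite_measure M by fact
  interpret N: finite_measure N by fact
  show "finite_measure (distr M (\<Pi>\<^sub>M i\<in>I. borel) (\<lambda>x. \<lambda>i\<in>I. V i x))"
    by (intro M.finite_measure_distr) measurable
  fix A :: "'i \<Rightarrow> real set" and J
  assume J: "finite J" "J \<subseteq> I" and A: "\<And>i. i \<in> J \<Longrightarrow> A i \<in> sets borel"
  let ?box = "prod_emb I (\<lambda>_. borel) J (Pi\<^sub>E J A)"
  have box: "?box \<in> sets (\<Pi>\<^sub>M i\<in>I. borel)"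
    using J A by (intro sets_PiM_I) auto
  have "emeasure (distr M (\<Pi>\<^sub>M i\<in>I. borel) (\<lambda>x. \<lambda>i\<in>I. V i x)) ?box =
      emeasure M {x\<in>space M. \<forall>i\<in>J. V i x \<in> A i}"
    using box J
    by (subst emeasure_distr)
      (auto intro!: arg_cong[where f = "emeasure M"] simp: prod_emb_iff PiE_iff subset_eq)
  also have "\<dots> = emeasure N {x\<in>space N. \<forall>i\<in>J. W i x \<in> A i}"
    using measure_box_eqI_charfun[OF J(1) M N, of V W A] J V W A charfun[OF J]
    by (auto simp: M.emeasure_eq_measure N.emeasure_eq_measure subset_eq)
  also have "\<dots> = emeasure (distr N (\<Pi>\<^sub>M i\<in>I. borel) (\<lambda>x. \<lambda>i\<in>I. W i x)) ?box"
    using box J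
    by (subst emeasure_distr)
      (auto intro!: arg_cong[where f = "emeasure N"] simp: prod_emb_iff PiE_iff subset_eq)
  finally show "emeasure (distr M (\<Pi>\<^sub>M i\<in>I. borel) (\<lambda>x. \<lambda>i\<in>I. V i x)) ?box =
    emeasure (distr N (\<Pi>\<^sub>M i\<in>I. borel) (\<lambda>x. \<lambda>i\<in>I. W i x)) ?box" .
qed simp_all

corollary measure_countable_box_eqI_charfun:
  fixes V :: "'i \<Rightarrow> 'a \<Rightarrow> real" and W :: "'i \<Rightarrow> 'b \<Rightarrow> real"
  assumes "finite_measure M" "finite_measure N" and I: "countable I"
    and V[measurable]: "\<And>i. i \<in> I \<Longrightarrow> V i \<in> borel_measurable M"
    and W[measurable]: "\<And>i. i \<in> I \<Longrightarrow> W i \<in> borel_measurable N"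
    and "\<And>J \<theta>. finite J \<Longrightarrow> J \<subseteq> I \<Longrightarrow>
      (\<integral>x. iexp (\<Sum>i\<in>J. \<theta> i * V i x) \<partial>M) = (\<integral>x. iexp (\<Sum>i\<in>J. \<theta> i * W i x) \<partial>N)"
    and [measurable]: "\<And>i. i \<in> I \<Longrightarrow> A i \<in> sets borel"
  shows "measure M {x\<in>space M. \<forall>i\<in>I. V i x \<in> A i} = measure N {x\<in>space N. \<forall>i\<in>I. W i x \<in> A i}"
proof -
  let ?P = "\<Pi>\<^sub>M i\<in>I. borel :: real measure"
  let ?box = "{f\<in>space ?P. \<forall>i\<in>I. f i \<in> A i}"
  have box: "?box \<in> sets ?P" using I by measurable
  have "measure M {x\<in>space M. \<forall>i\<in>I. V i x \<in> A i} = measure (distr M ?P (\<lambda>x. \<lambda>i\<in>I. V i x)) ?box"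
    using box by (subst measure_distr) (auto intro!: arg_cong[where f = "measure M"] simp: space_PiM)
  also have "\<dots> = measure (distr N ?P (\<lambda>x. \<lambda>i\<in>I. W i x)) ?box"
    using assms by (subst distr_PiM_eqI_charfun[of M N I V W]) auto
  also have "\<dots> = measure N {x\<in>space N. \<forall>i\<in>I. W i x \<in> A i}"
    using box by (subst measure_distr) (auto intro!: arg_cong[where f = "measure N"] simp: space_PiM)
  finally show ?thesis .
qed

section \<open>Centered normal random variables\<close>

abbreviation second_moment :: "'a measure \<Rightarrow> ('a \<Rightarrow> real) \<Rightarrow> real" where
  "second_moment M Y \<equiv> \<integral>x. (Y x)\<^sup>2 \<partial>M"



lemma normal_density_le_shift:
  assumes "0 \<le> r" "r \<le> y"
  shows "normal_density 0 \<sigma> y \<le> exp (- r\<^sup>2 / (2 * \<sigma>\<^sup>2)) * normal_density r \<sigma> y"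
proof -
  have "r * r \<le> r * y" using assms by (intro mult_left_mono) auto
  then have "- y\<^sup>2 \<le> - r\<^sup>2 + - (y - r)\<^sup>2" by (simp add: power2_eq_square algebra_simps)
  then have "- y\<^sup>2 / (2 * \<sigma>\<^sup>2) \<le> - r\<^sup>2 / (2 * \<sigma>\<^sup>2) + - (y - r)\<^sup>2 / (2 * \<sigma>\<^sup>2)"
    unfolding add_divide_distrib[symmetric] by (intro divide_right_mono) auto
  then have "exp (- y\<^sup>2 / (2 * \<sigma>\<^sup>2)) \<le> exp (- r\<^sup>2 / (2 * \<sigma>\<^sup>2)) * exp (- (y - r)\<^sup>2 / (2 * \<sigma>\<^sup>2))"
    unfolding exp_add[symmetric] by simp
  from mult_left_mono[OF this, of "1 / sqrt (2 * pi * \<sigma>\<^sup>2)"] show ?thesis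
    by (simp add: normal_density_def mult.left_commute)
qed

context prob_space
begin

lemma centered_normal_measurable: "centered_normal_rv M Y \<Longrightarrow> Y \<in> borel_measurable M"
  by (simp add: centered_normal_rv_def)

lemma centered_normal_cases:
  assumes "centered_normal_rv M Y"
  obtains "AE x in M. Y x = 0" "integrable M (\<lambda>x. (Y x)\<^sup>2)" "second_moment M Y = 0"
  | \<sigma> where "0 < \<sigma>" "distributed M lborel Y (normal_density 0 \<sigma>)"
      "integrable M (\<lambda>x. (Y x)\<^sup>2)" "second_moment M Y = \<sigma>\<^sup>2"
proof -
  note [measurable] = centered_normal_measurable[OF assms]
  consider "AE x in M. Y x = 0" | \<sigma> where "0 < \<sigma>" "distributed M lborel Y (normal_density 0 \<sigma>)"
    using assms by (auto simp: centered_normal_rv_def)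
  then show thesis
  proof cases
    case 1
    then have zero: "AE x in M. (Y x)\<^sup>2 = (\<lambda>_. 0) x" by simp
    have "integrable M (\<lambda>x. (Y x)\<^sup>2)" using zero by (subst integrable_cong_AE[OF _ _ zero]) auto
    moreover have "second_moment M Y = 0" by (subst integral_cong_AE[OF _ _ zero]) auto
    ultimately show thesis using that(1) 1 by blast
  next
    case 2
    have "integrable M (\<lambda>x. (Y x)\<^sup>2) \<longleftrightarrow> integrable lborel (\<lambda>x. normal_density 0 \<sigma> x * x\<^sup>2)"
      by (rule distributed_integrable[OF 2(2), symmetric]) auto
    moreover have "integrable lborel (\<lambda>x. normal_density 0 \<sigma> x * x\<^sup>2)"
      using integrable_normal_moment[OF 2(1), of 0 2] by simp
    moreover have "second_moment M Y = \<sigma>\<^sup>2"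
      using normal_distributed_variance[OF 2] normal_distributed_expectation[OF 2] by simp
    ultimately show thesis using that(2)[OF 2] by blast
  qed
qed

lemma centered_normal_square_integrable:
  assumes "centered_normal_rv M Y"
  shows "square_integrable M Y"
  using assms by (cases rule: centered_normal_cases)
    (simp_all add: square_integrable_real_iff centered_normal_measurable assms)

lemma centered_normal_charfun:
  assumes "centered_normal_rv M Y"
  shows "(\<integral>x. iexp (Y x) \<partial>M) = of_real (exp (- second_moment M Y / 2))"
proof -
  note [measurable] = centered_normal_measurable[OF assms]
  from assms show ?thesis
  proof (cases rule: centered_normal_cases)
    case 1
    then have "(\<integral>x. iexp (Y x) \<partial>M) = (\<integral>x. 1 \<partial>M)" by (intro integral_cong_AE) auto
    then show ?thesis using 1(3) by (simp add: prob_space)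
  next
    case (2 \<sigma>)
    have "distributed M lborel (\<lambda>x. (Y x - 0) / \<sigma>) std_normal_density"
      using normal_standard_normal_convert[OF 2(1)] 2(2) by blast
    then have std_normal: "distr M lborel (\<lambda>x. Y x / \<sigma>) = std_normal_distribution"
      by (simp add: distributed_distr_eq_density)
    have "(\<integral>x. iexp (Y x) \<partial>M) = (\<integral>x. iexp (\<sigma> * (Y x / \<sigma>)) \<partial>M)" using 2(1) by simp
    also have "\<dots> = (\<integral>y. iexp (\<sigma> * y) \<partial>distr M lborel (\<lambda>x. Y x / \<sigma>))"
      by (subst integral_distr) auto
    also have "\<dots> = char std_normal_distribution \<sigma>" unfolding std_normal char_def ..
    also have "\<dots> = of_real (exp (- (\<sigma>\<^sup>2) / 2))"
      using fun_cong[OF char_std_normal_distribution, of \<sigma>] by simp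
    finally show ?thesis using 2(4) by simp
  qed
qed

lemma centered_normal_upper_tail:
  assumes "centered_normal_rv M Y" "second_moment M Y \<le> v" "0 < v" "0 < r"
  shows "prob {x\<in>space M. r \<le> Y x} \<le> exp (- r\<^sup>2 / (2 * v))"
proof -
  note [measurable] = centered_normal_measurable[OF assms(1)]
  from assms(1) show ?thesis
  proof (cases rule: centered_normal_cases)
    case 1
    then have "AE x in M. \<not> r \<le> Y x" using \<open>0 < r\<close> by (elim AE_mp) auto
    then have "prob {x\<in>space M. r \<le> Y x} = 0"
      by (subst prob_Collect_eq_0) auto
    then show ?thesis by simp
  next
    case (2 \<sigma>)
    let ?c = "exp (- r\<^sup>2 / (2 * \<sigma>\<^sup>2))"
    have "emeasure M {x\<in>space M. r \<le> Y x} =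
        (\<integral>\<^sup>+y. ennreal (normal_density 0 \<sigma> y) * indicator {r..} y \<partial>lborel)"
      using distributed_emeasure[OF 2(2), of "{r..}"]
      by (simp add: vimage_def Int_def conj_commute)
    also have "\<dots> \<le> (\<integral>\<^sup>+y. ennreal (?c * normal_density r \<sigma> y) \<partial>lborel)"
      using normal_density_le_shift[of r _ \<sigma>] \<open>0 < r\<close>
      by (intro nn_integral_mono) (auto simp: indicator_def intro!: ennreal_leI)
    also have "\<dots> = ennreal (\<integral>y. ?c * normal_density r \<sigma> y \<partial>lborel)"
      using 2(1) by (intro nn_integral_eq_integral) auto
    also have "\<dots> = ennreal ?c" using 2(1) by simp
    finally have "prob {x\<in>space M. r \<le> Y x} \<le> ?c" by (simp add: emeasure_eq_measure)
    also have "?c \<le> exp (- r\<^sup>2 / (2 * v))"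
      using assms(2,3) 2(1,4) by (auto intro!: divide_left_mono)
    finally show ?thesis .
  qed
qed

lemma centered_normal_lower_tail:
  assumes "centered_normal_rv M Y" "0 < second_moment M Y" "0 \<le> r"
  shows "exp (- (r + 1)\<^sup>2 / (2 * second_moment M Y)) / sqrt (2 * pi * second_moment M Y)
    \<le> prob {x\<in>space M. r < Y x}"
proof -
  note [measurable] = centered_normal_measurable[OF assms(1)]
  from assms(1) show ?thesis
  proof (cases rule: centered_normal_cases)
    case 1
    then show ?thesis using assms by simp
  next
    case (2 \<sigma>)
    let ?c = "exp (- (r + 1)\<^sup>2 / (2 * \<sigma>\<^sup>2)) / sqrt (2 * pi * \<sigma>\<^sup>2)"
    have density_ge: "?c \<le> normal_density 0 \<sigma> y" if "r < y" "y \<le> r + 1" for y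
    proof -
      have "y\<^sup>2 \<le> (r + 1)\<^sup>2" using that assms(3) by (intro power_mono) auto
      then have "- (r + 1)\<^sup>2 / (2 * \<sigma>\<^sup>2) \<le> - y\<^sup>2 / (2 * \<sigma>\<^sup>2)"
        by (intro divide_right_mono) auto
      then show ?thesis
        unfolding normal_density_def by (auto intro!: divide_right_mono)
    qed
    have "ennreal ?c = (\<integral>\<^sup>+y. ennreal ?c * indicator {r<..r+1} y \<partial>lborel)"
      by (subst nn_integral_cmult_indicator) auto
    also have "\<dots> \<le> (\<integral>\<^sup>+y. ennreal (normal_density 0 \<sigma> y) * indicator {r<..} y \<partial>lborel)"
      using density_ge by (intro nn_integral_mono) (auto simp: indicator_def intro!: ennreal_leI)
    also have "\<dots> = emeasure M {x\<in>space M. r < Y x}"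
      using distributed_emeasure[OF 2(2), of "{r<..}"]
      by (simp add: vimage_def Int_def conj_commute)
    finally show ?thesis using 2(4) by (simp add: emeasure_eq_measure)
  qed
qed

lemma centered_normal_lower_tail_rate:
  assumes Y: "centered_normal_rv M Y" "second_moment M Y = p" "0 < p" and a: "0 \<le> a" "a\<^sup>2 / p < q"
  shows "\<forall>\<^sub>F u in at_top. C * exp (- q * u\<^sup>2 / 2) \<le> prob {x\<in>space M. a * u < Y x}"
proof -
  have "\<forall>\<^sub>F u in at_top. C * sqrt (2 * pi * p) \<le>
      exp ((q - a\<^sup>2 / p) / 2 * u\<^sup>2 + (- a / p) * u + (- 1 / (2 * p)))"
    using a by (intro eventually_le_exp_quadratic) auto
  then show ?thesis
    using eventually_ge_at_top[of 0]
  proof eventually_elim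
    case (elim u)
    have "(q - a\<^sup>2 / p) / 2 * u\<^sup>2 + (- a / p) * u + (- 1 / (2 * p)) + - q * u\<^sup>2 / 2 =
        - (a * u + 1)\<^sup>2 / (2 * p)"
      using Y(3) by (simp add: power2_eq_square field_simps)
    then have "C * sqrt (2 * pi * p) * exp (- q * u\<^sup>2 / 2) \<le> exp (- (a * u + 1)\<^sup>2 / (2 * p))"
      using mult_right_mono[OF elim(1), of "exp (- q * u\<^sup>2 / 2)"] by (simp add: exp_add[symmetric])
    then have "C * exp (- q * u\<^sup>2 / 2) \<le> exp (- (a * u + 1)\<^sup>2 / (2 * p)) / sqrt (2 * pi * p)"
      using Y(3) by (simp add: pos_le_divide_eq mult_ac)
    also have "\<dots> \<le> prob {x\<in>space M. a * u < Y x}"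
      using centered_normal_lower_tail[OF Y(1), of "a * u"] Y a elim(2) by simp
    finally show ?case .
  qed
qed

end

section \<open>Linear combinations of a Gaussian family\<close>

lemma lin_comb_finite_sum:
  assumes "finite I" "\<And>i. i \<in> I \<Longrightarrow> t i \<in> T"
  shows "lin_comb X T (\<lambda>x. \<Sum>i\<in>I. c i * X (t i) x)"
proof -
  obtain h where h: "bij_betw h {..<card I} I"
    using ex_bij_betw_nat_finite[OF \<open>finite I\<close>] by (auto simp: atLeast0LessThan)
  have "(\<lambda>x. \<Sum>i\<in>I. c i * X (t i) x) = (\<lambda>x. \<Sum>k<card I. c (h k) * X (t (h k)) x)"
    using sum.reindex_bij_betw[OF h, of "\<lambda>i. c i * X (t i) x" for x] by simp
  moreover have "\<forall>k<card I. t (h k) \<in> T"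
    using assms(2) bij_betwE[OF h] by auto
  ultimately show ?thesis
    unfolding lin_comb_def
    by (intro exI[of _ "card I"] exI[of _ "\<lambda>k. c (h k)"] exI[of _ "\<lambda>k. t (h k)"]) simp
qed

lemma lin_comb_point: "t \<in> T \<Longrightarrow> lin_comb X T (X t)"
  using lin_comb_finite_sum[of "{t}" id T X "\<lambda>_. 1"] by simp

lemma lin_comb_zero: "lin_comb X T (\<lambda>_. 0)"
  using lin_comb_finite_sum[of "{}" id T X "\<lambda>_. 1"] by simp

lemma lin_comb_scale:
  assumes "lin_comb X T Y"
  shows "lin_comb X T (\<lambda>x. r * Y x)"
proof -
  obtain n :: nat and c t where "\<forall>i<n. t i \<in> T" "Y = (\<lambda>x. \<Sum>i<n. c i * X (t i) x)"
    using assms unfolding lin_comb_def by blast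
  then show ?thesis
    using lin_comb_finite_sum[of "{..<n}" t T X "\<lambda>i. r * c i"] by (simp add: sum_distrib_left mult.assoc)
qed

lemma lin_comb_add:
  assumes "lin_comb X T Y" "lin_comb X T Z"
  shows "lin_comb X T (\<lambda>x. Y x + Z x)"
proof -
  obtain n :: nat and c t where "\<forall>i<n. t i \<in> T" and Y: "Y = (\<lambda>x. \<Sum>i<n. c i * X (t i) x)"
    using assms(1) unfolding lin_comb_def by blast
  obtain m :: nat and d s where "\<forall>i<m. s i \<in> T" and Z: "Z = (\<lambda>x. \<Sum>i<m. d i * X (s i) x)"
    using assms(2) unfolding lin_comb_def by blast
  have "lin_comb X T (\<lambda>x. \<Sum>k\<in>{..<n} <+> {..<m}. case_sum c d k * X (case_sum t s k) x)"
    using \<open>\<forall>i<n. t i \<in> T\<close> \<open>\<forall>i<m. s i \<in> T\<close> by (intro lin_comb_finite_sum) auto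
  then show ?thesis by (simp add: Y Z sum.Plus)
qed

lemma lin_comb_diff:
  "lin_comb X T Y \<Longrightarrow> lin_comb X T Z \<Longrightarrow> lin_comb X T (\<lambda>x. Y x - Z x)"
  using lin_comb_add[of X T Y "\<lambda>x. -1 * Z x"] lin_comb_scale[of X T Z "-1"] by simp

lemma lin_comb_sum:
  assumes "\<And>i. i \<in> I \<Longrightarrow> lin_comb X T (V i)"
  shows "lin_comb X T (\<lambda>x. \<Sum>i\<in>I. \<theta> i * V i x)"
  using assms
  by (induction I rule: infinite_finite_induct) (auto intro!: lin_comb_zero lin_comb_add lin_comb_scale)

lemma lin_comb_mono: "lin_comb X S Y \<Longrightarrow> S \<subseteq> T \<Longrightarrow> lin_comb X T Y"
  unfolding lin_comb_def by blast

locale gaussian_family = prob_space M for M :: "'a measure" +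
  fixes X :: "'d \<Rightarrow> 'a \<Rightarrow> real" and T :: "'d set"
  assumes gaussian: "centered_gaussian_field M X T"
begin

lemma lin_comb_normal: "lin_comb X T Y \<Longrightarrow> centered_normal_rv M Y"
  using gaussian by (simp add: centered_gaussian_field_def)

lemma lin_comb_measurable: "lin_comb X T Y \<Longrightarrow> Y \<in> borel_measurable M"
  by (intro centered_normal_measurable lin_comb_normal)

lemma lin_comb_square_integrable: "lin_comb X T Y \<Longrightarrow> square_integrable M Y"
  by (intro centered_normal_square_integrable lin_comb_normal)

lemma point_square_integrable: "t \<in> T \<Longrightarrow> square_integrable M (X t)"
  by (intro lin_comb_square_integrable lin_comb_point)

lemma point_measurable: "t \<in> T \<Longrightarrow> X t \<in> borel_measurable M"
  by (intro lin_comb_measurable lin_comb_point)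

lemma lin_comb_mult_integrable:
  assumes "lin_comb X T Y" "lin_comb X T Z"
  shows "integrable M (\<lambda>x. Y x * Z x)"
  using integrable_inner[OF assms[THEN lin_comb_square_integrable]] by simp

lemma second_moment_lin_comb2:
  assumes "lin_comb X T Y" "lin_comb X T Z"
  shows "second_moment M (\<lambda>x. a * Y x + b * Z x) =
    a\<^sup>2 * second_moment M Y + 2 * a * b * (\<integral>x. Y x * Z x \<partial>M) + b\<^sup>2 * second_moment M Z"
proof -
  have "(a * Y x + b * Z x)\<^sup>2 = a\<^sup>2 * (Y x)\<^sup>2 + 2 * a * b * (Y x * Z x) + b\<^sup>2 * (Z x)\<^sup>2" for x
    by (simp add: power2_eq_square algebra_simps)
  then show ?thesis
    using assms[THEN lin_comb_square_integrable] lin_comb_mult_integrable[OF assms]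
    by (simp add: square_integrable_real_iff)
qed

lemma lin_comb_charfun:
  "lin_comb X T Y \<Longrightarrow> (\<integral>x. iexp (Y x) \<partial>M) = of_real (exp (- second_moment M Y / 2))"
  by (intro centered_normal_charfun lin_comb_normal)

lemma lin_comb_pair_charfun:
  assumes Y: "lin_comb X T Y" and Z: "lin_comb X T Z"
  shows "(\<integral>z. iexp (Y (fst z) + Z (snd z)) \<partial>(M \<Otimes>\<^sub>M M)) =
    of_real (exp (- (second_moment M Y + second_moment M Z) / 2))"
proof -
  interpret P: pair_prob_space M M ..
  note [measurable] = lin_comb_measurable[OF Y] lin_comb_measurable[OF Z]
  have "integrable (M \<Otimes>\<^sub>M M) (\<lambda>z. iexp (Y (fst z) + Z (snd z)))"
    by (rule P.integrable_iexp) measurable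
  then have "(\<integral>z. iexp (Y (fst z) + Z (snd z)) \<partial>(M \<Otimes>\<^sub>M M)) = (\<integral>x. (\<integral>y. iexp (Y x + Z y) \<partial>M) \<partial>M)"
    by (subst P.integral_fst'[symmetric]) (auto simp: split_def)
  also have "\<dots> = (\<integral>x. iexp (Y x) \<partial>M) * (\<integral>y. iexp (Z y) \<partial>M)"
    by (simp add: distrib_left exp_add)
  also have "\<dots> = of_real (exp (- second_moment M Y / 2) * exp (- second_moment M Z / 2))"
    by (simp add: lin_comb_charfun[OF Y] lin_comb_charfun[OF Z])
  finally show ?thesis
    unfolding exp_add[symmetric] by (simp add: add_divide_distrib diff_divide_distrib)
qed

lemma sum_sum_type:
  assumes "finite K"
  shows "(\<Sum>k\<in>K. f k) = (\<Sum>i\<in>Inl -` K. f (Inl i)) + (\<Sum>j\<in>Inr -` K. f (Inr j))"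
proof -
  have "k \<in> Inl -` K <+> Inr -` K \<longleftrightarrow> k \<in> K" for k by (cases k) auto
  then have "Inl -` K <+> Inr -` K = K" by blast
  then show ?thesis
    using sum.Plus[of "Inl -` K" "Inr -` K" f] assms by (simp add: finite_vimageI)
qed

lemma measure_box_eq_prod:
  fixes P :: "'i \<Rightarrow> 'b \<Rightarrow> real" and Q :: "'j \<Rightarrow> 'b \<Rightarrow> real"
  assumes N: "finite_measure N" and countable: "countable I" "countable J"
    and V: "\<And>i. i \<in> I \<Longrightarrow> lin_comb X T (V i)" and W: "\<And>j. j \<in> J \<Longrightarrow> lin_comb X T (W j)"
    and PQ: "\<And>i. i \<in> I \<Longrightarrow> P i \<in> borel_measurable N" "\<And>j. j \<in> J \<Longrightarrow> Q j \<in> borel_measurable N"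
    and charfun: "\<And>I' J' \<theta> \<eta>. finite I' \<Longrightarrow> I' \<subseteq> I \<Longrightarrow> finite J' \<Longrightarrow> J' \<subseteq> J \<Longrightarrow>
      (\<integral>z. iexp ((\<Sum>i\<in>I'. \<theta> i * P i z) + (\<Sum>j\<in>J'. \<eta> j * Q j z)) \<partial>N) =
      of_real (exp (- (second_moment M (\<lambda>x. \<Sum>i\<in>I'. \<theta> i * V i x) +
        second_moment M (\<lambda>x. \<Sum>j\<in>J'. \<eta> j * W j x)) / 2))"
    and AB[measurable]: "A \<in> sets borel" "B \<in> sets borel"
  shows "measure N {z\<in>space N. (\<forall>i\<in>I. P i z \<in> A) \<and> (\<forall>j\<in>J. Q j z \<in> B)} =
    prob {x\<in>space M. \<forall>i\<in>I. V i x \<in> A} * prob {x\<in>space M. \<forall>j\<in>J. W j x \<in> B}"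
proof -
  interpret MM: pair_prob_space M M ..
  note VW[measurable] = V[THEN lin_comb_measurable] W[THEN lin_comb_measurable]
  let ?PQ = "case_sum P Q"
  let ?VW = "case_sum (\<lambda>i z. V i (fst z)) (\<lambda>j z. W j (snd z))"
  let ?AB = "case_sum (\<lambda>_. A) (\<lambda>_. B)"
  have "measure N {z\<in>space N. \<forall>k\<in>I <+> J. ?PQ k z \<in> ?AB k} =
    measure (M \<Otimes>\<^sub>M M) {z\<in>space (M \<Otimes>\<^sub>M M). \<forall>k\<in>I <+> J. ?VW k z \<in> ?AB k}"
  proof (rule measure_countable_box_eqI_charfun[OF N MM.finite_measure_axioms])
    fix K :: "('i + 'j) set" and \<theta> assume K: "finite K" "K \<subseteq> I <+> J"
    let ?I' = "Inl -` K" and ?J' = "Inr -` K"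
    have I': "finite ?I'" "?I' \<subseteq> I" and J': "finite ?J'" "?J' \<subseteq> J"
      using K by (auto intro!: finite_vimageI)
    have "lin_comb X T (\<lambda>x. \<Sum>i\<in>?I'. \<theta> (Inl i) * V i x)" "lin_comb X T (\<lambda>x. \<Sum>j\<in>?J'. \<theta> (Inr j) * W j x)"
      using I' J' by (auto intro!: lin_comb_sum V W)
    from lin_comb_pair_charfun[OF this] charfun[OF I' J', of "\<lambda>i. \<theta> (Inl i)" "\<lambda>j. \<theta> (Inr j)"]
    show "(\<integral>z. iexp (\<Sum>k\<in>K. \<theta> k * ?PQ k z) \<partial>N) = (\<integral>z. iexp (\<Sum>k\<in>K. \<theta> k * ?VW k z) \<partial>(M \<Otimes>\<^sub>M M))"
      by (simp add: sum_sum_type[OF K(1)])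
  qed (use countable PQ AB in auto)
  moreover have "{z\<in>space N. \<forall>k\<in>I <+> J. ?PQ k z \<in> ?AB k} =
      {z\<in>space N. (\<forall>i\<in>I. P i z \<in> A) \<and> (\<forall>j\<in>J. Q j z \<in> B)}"
    by (auto simp: Plus_def ball_Un)
  moreover have "{z\<in>space (M \<Otimes>\<^sub>M M). \<forall>k\<in>I <+> J. ?VW k z \<in> ?AB k} =
      {x\<in>space M. \<forall>i\<in>I. V i x \<in> A} \<times> {x\<in>space M. \<forall>j\<in>J. W j x \<in> B}"
    by (auto simp: Plus_def ball_Un space_pair_measure)
  moreover have "{x\<in>space M. \<forall>i\<in>I. V i x \<in> A} \<in> events" "{x\<in>space M. \<forall>j\<in>J. W j x \<in> B} \<in> events"
    using countable by measurable
  ultimately show ?thesis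
    by (simp add: measure_def emeasure_pair_measure_Times enn2real_mult)
qed

lemma prob_joint_uncorrelated:
  fixes V :: "'i \<Rightarrow> 'a \<Rightarrow> real" and W :: "'j \<Rightarrow> 'a \<Rightarrow> real"
  assumes countable: "countable I" "countable J"
    and V: "\<And>i. i \<in> I \<Longrightarrow> lin_comb X T (V i)" and W: "\<And>j. j \<in> J \<Longrightarrow> lin_comb X T (W j)"
    and uncorrelated: "\<And>i j. i \<in> I \<Longrightarrow> j \<in> J \<Longrightarrow> (\<integral>x. V i x * W j x \<partial>M) = 0"
    and "A \<in> sets borel" "B \<in> sets borel"
  shows "prob {x\<in>space M. (\<forall>i\<in>I. V i x \<in> A) \<and> (\<forall>j\<in>J. W j x \<in> B)} =
    prob {x\<in>space M. \<forall>i\<in>I. V i x \<in> A} * prob {x\<in>space M. \<forall>j\<in>J. W j x \<in> B}"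
proof (rule measure_box_eq_prod[OF finite_measure_axioms countable V W])
  fix I' J' \<theta> \<eta> assume sub: "finite I'" "I' \<subseteq> I" "finite J'" "J' \<subseteq> J"
  define F where "F = (\<lambda>x. \<Sum>i\<in>I'. \<theta> i * V i x)"
  define G where "G = (\<lambda>x. \<Sum>j\<in>J'. \<eta> j * W j x)"
  have F: "lin_comb X T F" and G: "lin_comb X T G"
    unfolding F_def G_def using sub by (auto intro!: lin_comb_sum V W)
  have "(\<integral>x. F x * G x \<partial>M) = (\<integral>x. (\<Sum>i\<in>I'. \<Sum>j\<in>J'. \<theta> i * \<eta> j * (V i x * W j x)) \<partial>M)"
    by (simp add: F_def G_def sum_product mult_ac)
  also have "\<dots> = (\<Sum>i\<in>I'. \<Sum>j\<in>J'. \<theta> i * \<eta> j * (\<integral>x. V i x * W j x \<partial>M))"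
    using sub lin_comb_mult_integrable[OF V W] by (simp add: subset_eq)
  also have "\<dots> = 0" using sub uncorrelated by (intro sum.neutral ballI) auto
  finally have "second_moment M (\<lambda>x. F x + G x) = second_moment M F + second_moment M G"
    using second_moment_lin_comb2[OF F G, of 1 1] by simp
  then show "(\<integral>x. iexp ((\<Sum>i\<in>I'. \<theta> i * V i x) + (\<Sum>j\<in>J'. \<eta> j * W j x)) \<partial>M) =
      of_real (exp (- (second_moment M (\<lambda>x. \<Sum>i\<in>I'. \<theta> i * V i x) +
        second_moment M (\<lambda>x. \<Sum>j\<in>J'. \<eta> j * W j x)) / 2))"
    using lin_comb_charfun[OF lin_comb_add[OF F G]] by (simp add: F_def G_def)
qed (use assms in \<open>auto intro: lin_comb_measurable\<close>)

lemma prob_rotated_pair: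
  fixes V :: "'i \<Rightarrow> 'a \<Rightarrow> real"
  assumes I: "countable I" and V: "\<And>i. i \<in> I \<Longrightarrow> lin_comb X T (V i)"
    and "A \<in> sets borel" "B \<in> sets borel"
  shows "measure (M \<Otimes>\<^sub>M M) {z\<in>space (M \<Otimes>\<^sub>M M).
      (\<forall>i\<in>I. (V i (fst z) - V i (snd z)) / sqrt 2 \<in> A) \<and> (\<forall>i\<in>I. (V i (fst z) + V i (snd z)) / sqrt 2 \<in> B)} =
    prob {x\<in>space M. \<forall>i\<in>I. V i x \<in> A} * prob {x\<in>space M. \<forall>i\<in>I. V i x \<in> B}"
proof -
  interpret MM: pair_prob_space M M ..
  note [measurable] = V[THEN lin_comb_measurable]
  let ?r = "1 / sqrt 2"
  show ?thesis
  proof (rule measure_box_eq_prod[OF MM.finite_measure_axioms I I V V])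
    fix I' J' and \<theta> \<eta> :: "'i \<Rightarrow> real" assume sub: "finite I'" "I' \<subseteq> I" "finite J'" "J' \<subseteq> I"
    define F where "F = (\<lambda>x. \<Sum>i\<in>I'. \<theta> i * V i x)"
    define G where "G = (\<lambda>x. \<Sum>i\<in>J'. \<eta> i * V i x)"
    have F: "lin_comb X T F" and G: "lin_comb X T G"
      unfolding F_def G_def using sub by (auto intro!: lin_comb_sum V)
    have FG: "lin_comb X T (\<lambda>x. ?r * F x + ?r * G x)" "lin_comb X T (\<lambda>x. (- ?r) * F x + ?r * G x)"
      by (intro lin_comb_add lin_comb_scale F G)+
    have "(\<Sum>i\<in>I'. \<theta> i * ((V i (fst z) - V i (snd z)) / sqrt 2)) +
        (\<Sum>i\<in>J'. \<eta> i * ((V i (fst z) + V i (snd z)) / sqrt 2)) =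
      (?r * F (fst z) + ?r * G (fst z)) + ((- ?r) * F (snd z) + ?r * G (snd z))" for z
      unfolding F_def G_def
      by (simp add: diff_divide_distrib add_divide_distrib right_diff_distrib distrib_left
          sum_subtractf sum.distrib sum_divide_distrib)
    moreover have "second_moment M (\<lambda>x. ?r * F x + ?r * G x) +
        second_moment M (\<lambda>x. (- ?r) * F x + ?r * G x) =
      second_moment M F + second_moment M G"
      unfolding second_moment_lin_comb2[OF F G] by (simp add: power_divide)
    ultimately show "(\<integral>z. iexp ((\<Sum>i\<in>I'. \<theta> i * ((V i (fst z) - V i (snd z)) / sqrt 2)) +
          (\<Sum>i\<in>J'. \<eta> i * ((V i (fst z) + V i (snd z)) / sqrt 2))) \<partial>(M \<Otimes>\<^sub>M M)) =
        of_real (exp (- (second_moment M (\<lambda>x. \<Sum>i\<in>I'. \<theta> i * V i x) +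
          second_moment M (\<lambda>x. \<Sum>j\<in>J'. \<eta> j * V j x)) / 2))"
      using lin_comb_pair_charfun[OF FG] by (simp only:) (simp only: F_def G_def)
  qed (use assms in auto)
qed

end

section \<open>Fernique's theorem\<close>

lemma abs_gt_of_rotated:
  fixes a b :: real
  assumes "\<bar>(a - b) / sqrt 2\<bar> \<le> s" "t < \<bar>(a + b) / sqrt 2\<bar>"
  shows "(t - s) / sqrt 2 < \<bar>a\<bar>" "(t - s) / sqrt 2 < \<bar>b\<bar>"
proof -
  define d where "d = (a - b) / sqrt 2"
  define e where "e = (a + b) / sqrt 2"
  have "a = (e + d) / sqrt 2" "b = (e - d) / sqrt 2"
    by (simp_all add: d_def e_def field_simps)
  moreover have "t - s < \<bar>e + d\<bar>" "t - s < \<bar>e - d\<bar>"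
    using assms unfolding d_def[symmetric] e_def[symmetric] by linarith+
  ultimately show "(t - s) / sqrt 2 < \<bar>a\<bar>" "(t - s) / sqrt 2 < \<bar>b\<bar>"
    by (simp_all add: divide_strict_right_mono)
qed

lemma (in prob_space) prob_exists_gt:
  fixes V :: "'i \<Rightarrow> 'a \<Rightarrow> real"
  assumes I: "countable I" and [measurable]: "\<And>i. i \<in> I \<Longrightarrow> V i \<in> borel_measurable M"
  shows "prob {x\<in>space M. \<exists>i\<in>I. r < \<bar>V i x\<bar>} = 1 - prob {x\<in>space M. \<forall>i\<in>I. \<bar>V i x\<bar> \<le> r}"
proof -
  have "{x\<in>space M. \<forall>i\<in>I. \<bar>V i x\<bar> \<le> r} \<in> events" using I by measurable
  moreover have "{x\<in>space M. \<exists>i\<in>I. r < \<bar>V i x\<bar>} = space M - {x\<in>space M. \<forall>i\<in>I. \<bar>V i x\<bar> \<le> r}"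
    by (auto simp: not_le[symmetric])
  ultimately show ?thesis by (simp add: prob_compl)
qed

context gaussian_family
begin

lemma prob_rotation_bound:
  fixes V :: "'i \<Rightarrow> 'a \<Rightarrow> real"
  assumes I: "countable I" and V: "\<And>i. i \<in> I \<Longrightarrow> lin_comb X T (V i)"
  shows "prob {x\<in>space M. \<forall>i\<in>I. \<bar>V i x\<bar> \<le> s} * prob {x\<in>space M. \<exists>i\<in>I. t < \<bar>V i x\<bar>} \<le>
    (prob {x\<in>space M. \<exists>i\<in>I. (t - s) / sqrt 2 < \<bar>V i x\<bar>})\<^sup>2"
proof -
  interpret MM: pair_prob_space M M ..
  note [measurable] = V[THEN lin_comb_measurable]
  let ?MM = "M \<Otimes>\<^sub>M M" and ?q = "(t - s) / sqrt 2"
  let ?D = "\<lambda>i z. (V i (fst z) - V i (snd z)) / sqrt 2"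
  let ?S = "\<lambda>i z. (V i (fst z) + V i (snd z)) / sqrt 2"
  let ?le = "\<lambda>r. {x\<in>space M. \<forall>i\<in>I. \<bar>V i x\<bar> \<le> r}" and ?gt = "\<lambda>r. {x\<in>space M. \<exists>i\<in>I. r < \<bar>V i x\<bar>}"
  let ?A = "{z\<in>space ?MM. (\<forall>i\<in>I. ?D i z \<in> {- s..s}) \<and> (\<forall>i\<in>I. ?S i z \<in> UNIV)}"
  let ?B = "{z\<in>space ?MM. (\<forall>i\<in>I. ?D i z \<in> {- s..s}) \<and> (\<forall>i\<in>I. ?S i z \<in> {- t..t})}"
  have [measurable]: "?gt r \<in> events" for r using I by measurable
  have le_box: "{x\<in>space M. \<forall>i\<in>I. V i x \<in> {- r..r}} = ?le r" for r
    by (auto simp: abs_le_iff minus_le_iff)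
  have "prob (?le s) * prob (?gt t) = prob (?le s) - prob (?le s) * prob (?le t)"
    using I V by (subst prob_exists_gt) (auto simp: right_diff_distrib lin_comb_measurable)
  also have "\<dots> = measure ?MM ?A - measure ?MM ?B"
    by (subst (1 2) prob_rotated_pair[OF I V]) (simp_all only: le_box, auto simp: prob_space)
  also have "\<dots> = measure ?MM (?A - ?B)"
    using I by (intro MM.finite_measure_Diff[symmetric]) (measurable, auto)
  also have "\<dots> \<le> measure ?MM (?gt ?q \<times> ?gt ?q)"
  proof (rule MM.finite_measure_mono)
    show "?A - ?B \<subseteq> ?gt ?q \<times> ?gt ?q"
    proof
      fix z assume z: "z \<in> ?A - ?B"
      then obtain i where i: "i \<in> I" "?D i z \<in> {- s..s}" "?S i z \<notin> {- t..t}" by blast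
      have "\<bar>?D i z\<bar> \<le> s" "t < \<bar>?S i z\<bar>"
        using i(2,3) unfolding atLeastAtMost_iff by linarith+
      then have "?q < \<bar>V i (fst z)\<bar>" "?q < \<bar>V i (snd z)\<bar>"
        by (rule abs_gt_of_rotated)+
      then show "z \<in> ?gt ?q \<times> ?gt ?q"
        using z i(1) by (cases z) (auto simp: space_pair_measure)
    qed
  qed simp
  also have "\<dots> = (prob (?gt ?q))\<^sup>2"
    by (simp add: measure_def emeasure_pair_measure_Times enn2real_mult power2_eq_square)
  finally show ?thesis .
qed

lemma fernique_geometric_bound:
  fixes V :: "'i \<Rightarrow> 'a \<Rightarrow> real"
  assumes I: "countable I" and V: "\<And>i. i \<in> I \<Longrightarrow> lin_comb X T (V i)" and s: "0 < s"
    and three_quarters: "3 / 4 \<le> prob {x\<in>space M. \<forall>i\<in>I. \<bar>V i x\<bar> \<le> s}"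
    and r: "s * (4 * sqrt 2 ^ n - 3) \<le> r"
  shows "prob {x\<in>space M. \<exists>i\<in>I. r < \<bar>V i x\<bar>} \<le> prob {x\<in>space M. \<forall>i\<in>I. \<bar>V i x\<bar> \<le> s} * (1 / 3) ^ (2 ^ n)"
    (is "?gt r \<le> ?p * _")
  using r
proof (induction n arbitrary: r)
  note [measurable] = V[THEN lin_comb_measurable]
  have [measurable]: "{x\<in>space M. \<exists>i\<in>I. r < \<bar>V i x\<bar>} \<in> events" for r
    using I by measurable
  case 0
  then have "?gt r \<le> ?gt s"
    by (intro finite_measure_mono) (auto intro: le_less_trans)
  also have "\<dots> = 1 - ?p"
    using I by (rule prob_exists_gt) simp
  also have "\<dots> \<le> ?p * (1 / 3)" using three_quarters by simp
  finally show ?case by simp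
next
  case (Suc n)
  have "4 / 3 \<le> sqrt (2::real)"
    by (rule real_le_rsqrt) (simp add: power2_eq_square)
  then have "s * (4 * sqrt 2 ^ n - 3) * sqrt 2 + s \<le> s * (4 * sqrt 2 ^ Suc n - 3)"
    using s by (simp add: algebra_simps)
  then have "s * (4 * sqrt 2 ^ n - 3) \<le> (r - s) / sqrt 2"
    using Suc.prems by (simp add: pos_le_divide_eq)
  note IH = Suc.IH[OF this]
  have "?p * ?gt r \<le> (?gt ((r - s) / sqrt 2))\<^sup>2"
    using I V by (rule prob_rotation_bound)
  also have "\<dots> \<le> (?p * (1 / 3) ^ (2 ^ n))\<^sup>2"
    using IH by (intro power_mono) auto
  also have "\<dots> = ?p * (?p * (1 / 3) ^ (2 ^ Suc n))"
    by (simp add: power2_eq_square mult_2 power_add mult_ac)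
  finally show ?case using three_quarters by simp
qed

theorem fernique:
  fixes V :: "'i \<Rightarrow> 'a \<Rightarrow> real"
  assumes I: "countable I" and V: "\<And>i. i \<in> I \<Longrightarrow> lin_comb X T (V i)" and s: "0 < s"
    and three_quarters: "3 / 4 \<le> prob {x\<in>space M. \<forall>i\<in>I. \<bar>V i x\<bar> \<le> s}" and t: "4 * s \<le> t"
  shows "prob {x\<in>space M. \<exists>i\<in>I. t < \<bar>V i x\<bar>} \<le> exp (- t\<^sup>2 / (32 * s\<^sup>2))"
proof -
  define y where "y = t\<^sup>2 / (16 * s\<^sup>2)"
  have "(4 * s)\<^sup>2 \<le> t\<^sup>2" using t s by (intro power_mono) auto
  then have "1 \<le> y" using s by (simp add: y_def power_mult_distrib)
  then obtain n where n: "2 ^ n \<le> y" "y < 2 ^ Suc n"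
    by (rule power_two_bracket_obtains)
  have "(sqrt 2 ^ n)\<^sup>2 = (2::real) ^ n" by (simp flip: real_sqrt_power)
  then have "(4 * s * sqrt 2 ^ n)\<^sup>2 \<le> t\<^sup>2"
    using n(1) s by (simp add: y_def power_mult_distrib pos_le_divide_eq mult_ac)
  then have "4 * s * sqrt 2 ^ n \<le> t" using t s by (auto dest: power2_le_imp_le)
  then have "s * (4 * sqrt 2 ^ n - 3) \<le> t" using s by (simp add: algebra_simps)
  from fernique_geometric_bound[OF I V s three_quarters this]
  have "prob {x\<in>space M. \<exists>i\<in>I. t < \<bar>V i x\<bar>} \<le> prob {x\<in>space M. \<forall>i\<in>I. \<bar>V i x\<bar> \<le> s} * (1 / 3) ^ (2 ^ n)" .
  also have "\<dots> \<le> 1 * exp (- 1) ^ (2 ^ n)"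
    using exp_le by (intro mult_mono power_mono) (auto simp: exp_minus field_simps)
  also have "\<dots> = exp (- (2 ^ n))" by (simp add: exp_of_nat_mult[symmetric])
  also have "\<dots> \<le> exp (- t\<^sup>2 / (32 * s\<^sup>2))"
    using n(2) by (simp add: y_def)
  finally show ?thesis .
qed

end

section \<open>Convex combinations and duality\<close>

definition convex_comb :: "('d \<Rightarrow> 'a \<Rightarrow> real) \<Rightarrow> 'd set \<Rightarrow> ('a \<Rightarrow> real) \<Rightarrow> bool" where
  "convex_comb X K Y \<longleftrightarrow> (\<exists>S c. finite S \<and> S \<subseteq> K \<and> (\<forall>t\<in>S. 0 \<le> c t) \<and> (\<Sum>t\<in>S. c t) = 1 \<and>
     Y = (\<lambda>x. \<Sum>t\<in>S. c t * X t x))"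

definition least_variance :: "'a measure \<Rightarrow> ('d \<Rightarrow> 'a \<Rightarrow> real) \<Rightarrow> 'd set \<Rightarrow> real" where
  "least_variance M X K = (INF Y\<in>{Y. convex_comb X K Y}. second_moment M Y)"

lemma convex_comb_obtains:
  assumes "convex_comb X K Y"
  obtains S c where "finite S" "S \<subseteq> K" "\<forall>t\<in>S. 0 \<le> c t" "(\<Sum>t\<in>S. c t) = 1"
    "Y = (\<lambda>x. \<Sum>t\<in>S. c t * X t x)"
  using assms unfolding convex_comb_def by blast

lemma convex_comb_imp_lin_comb:
  assumes "convex_comb X K Y"
  shows "lin_comb X K Y"
proof -
  obtain S c where "finite S" "S \<subseteq> K" "Y = (\<lambda>x. \<Sum>t\<in>S. c t * X t x)"
    using assms by (rule convex_comb_obtains)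
  then show ?thesis using lin_comb_finite_sum[of S id K X c] by auto
qed

lemma convex_comb_point: "t \<in> K \<Longrightarrow> convex_comb X K (X t)"
  unfolding convex_comb_def by (intro exI[of _ "{t}"] exI[of _ "\<lambda>_. 1"]) auto

lemma convex_comb_mix:
  assumes "convex_comb X K Y" "t \<in> K" "0 \<le> s" "s \<le> 1"
  shows "convex_comb X K (\<lambda>x. (1 - s) * Y x + s * X t x)"
proof -
  obtain S c where S: "finite S" "S \<subseteq> K" "\<forall>r\<in>S. 0 \<le> c r" "(\<Sum>r\<in>S. c r) = 1"
    and Y: "Y = (\<lambda>x. \<Sum>r\<in>S. c r * X r x)"
    using assms(1) by (rule convex_comb_obtains)
  define c' where "c' r = (1 - s) * (if r \<in> S then c r else 0) + s * (if r = t then 1 else 0)" for r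
  have sum_c': "(\<Sum>r\<in>insert t S. c' r * f r) = (1 - s) * (\<Sum>r\<in>S. c r * f r) + s * f t" for f :: "_ \<Rightarrow> real"
  proof -
    have "(\<Sum>r\<in>insert t S. (if r \<in> S then c r else 0) * f r) = (\<Sum>r\<in>S. c r * f r)"
      using S(1) by (intro sum.mono_neutral_cong_right) auto
    moreover have "(\<Sum>r\<in>insert t S. (if r = t then 1 else 0) * f r) = f t"
      using S(1) by (subst sum.mono_neutral_cong_right[of _ "{t}" _ "\<lambda>_. f t"]) auto
    ultimately show ?thesis
      by (simp add: c'_def distrib_right sum.distrib mult.assoc flip: sum_distrib_left del: sum.insert)
  qed
  show ?thesis
    unfolding convex_comb_def
  proof (intro exI conjI)
    show "(\<Sum>r\<in>insert t S. c' r) = 1" using sum_c'[of "\<lambda>_. 1"] S(4) by simp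
    show "(\<lambda>x. (1 - s) * Y x + s * X t x) = (\<lambda>x. \<Sum>r\<in>insert t S. c' r * X r x)"
      unfolding sum_c' Y ..
    show "\<forall>r\<in>insert t S. 0 \<le> c' r" using S(3) assms by (auto simp: c'_def)
  qed (use S assms in auto)
qed

lemma le_convex_sum:
  fixes c f :: "'i \<Rightarrow> real"
  assumes "\<And>i. i \<in> I \<Longrightarrow> 0 \<le> c i" "(\<Sum>i\<in>I. c i) = 1" "\<And>i. i \<in> I \<Longrightarrow> r \<le> f i"
  shows "r \<le> (\<Sum>i\<in>I. c i * f i)"
proof -
  have "r = (\<Sum>i\<in>I. c i * r)" using assms(2) by (simp flip: sum_distrib_right)
  also have "\<dots> \<le> (\<Sum>i\<in>I. c i * f i)" using assms by (intro sum_mono mult_left_mono) auto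
  finally show ?thesis .
qed

lemma convex_comb_ge:
  assumes "convex_comb X K Y" "\<And>t. t \<in> K \<Longrightarrow> r \<le> X t x"
  shows "r \<le> Y x"
proof -
  obtain S c where "finite S" and S: "S \<subseteq> K" "\<forall>t\<in>S. 0 \<le> c t" "(\<Sum>t\<in>S. c t) = 1"
    and Y: "Y = (\<lambda>x. \<Sum>t\<in>S. c t * X t x)"
    using assms(1) by (rule convex_comb_obtains)
  show ?thesis unfolding Y using S assms(2) by (intro le_convex_sum) auto
qed

lemma least_variance_le: "convex_comb X K Y \<Longrightarrow> least_variance M X K \<le> second_moment M Y"
  unfolding least_variance_def by (rule cINF_lower) (auto intro!: bdd_belowI[of _ 0])

lemma least_variance_ge:
  assumes "K \<noteq> {}" "\<And>Y. convex_comb X K Y \<Longrightarrow> v \<le> second_moment M Y"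
  shows "v \<le> least_variance M X K"
  unfolding least_variance_def using assms convex_comb_point by (intro cINF_greatest) fast+

lemma least_variance_lessD:
  assumes "K \<noteq> {}" "least_variance M X K < v"
  shows "\<exists>Y. convex_comb X K Y \<and> second_moment M Y < v"
  using least_variance_ge[OF assms(1), of X v M] assms(2) by (meson not_less)

text \<open>A near-minimiser \<open>Y\<close> of the variance cannot gain much by a step of size \<open>s\<close> towards \<open>X t\<close>. So the
  first-order condition \<open>E (X t * Y) \<ge> E Y\<^sup>2\<close> holds up to an error of order \<open>s\<close>, provided that \<open>Y\<close> is
  within \<open>s\<^sup>2\<close> of the infimum.\<close>

lemma (in gaussian_family) near_minimiser_first_order:
  assumes K: "K \<subseteq> T" and t: "t \<in> K" and B: "second_moment M (X t) \<le> B"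
    and Y: "convex_comb X K Y" "second_moment M Y < least_variance M X K + s\<^sup>2" and s: "0 < s" "s \<le> 1"
  shows "least_variance M X K - s * (3 + 2 * B + 2 * least_variance M X K) / 2 \<le> w_H M X Y t"
proof -
  define m where "m = least_variance M X K"
  define A where "A = second_moment M Y"
  define b where "b = second_moment M (X t)"
  define w where "w = w_H M X Y t"
  note lin_Y = lin_comb_mono[OF convex_comb_imp_lin_comb[OF Y(1)] K]
  note lin_t = lin_comb_point[OF subsetD[OF K t], of X]
  have w: "w = (\<integral>x. Y x * X t x \<partial>M)" by (simp add: w_def w_H_def mult.commute)
  have A: "m \<le> A" "A < m + s\<^sup>2"
    using least_variance_le[OF Y(1), of M] Y(2) by (simp_all add: m_def A_def)
  have "0 \<le> second_moment M (\<lambda>x. 1 * Y x + 1 * X t x)" by simp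
  then have "- w \<le> (A + b) / 2"
    unfolding second_moment_lin_comb2[OF lin_Y lin_t] w[symmetric] A_def b_def by simp
  then have "A + b - 2 * w \<le> 2 * (A + b)" by simp
  also have "\<dots> \<le> 2 * (m + 1 + B)"
    using A(2) power_le_one[of s 2] s B by (simp add: b_def)
  finally have remainder: "s\<^sup>2 * (A + b - 2 * w) \<le> s\<^sup>2 * (2 * (m + 1 + B))" by (rule mult_left_mono) simp
  have "m \<le> (1 - s)\<^sup>2 * A + 2 * (1 - s) * s * w + s\<^sup>2 * b"
    using least_variance_le[OF convex_comb_mix[OF Y(1) t, of s], of M] s
    unfolding second_moment_lin_comb2[OF lin_Y lin_t] w[symmetric] A_def[symmetric] b_def[symmetric]
      m_def[symmetric]
    by simp
  also have "\<dots> = A + 2 * s * (w - A) + s\<^sup>2 * (A + b - 2 * w)"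
    by (simp add: power2_eq_square algebra_simps)
  also have "\<dots> \<le> m + s\<^sup>2 + 2 * s * (w - m) + s\<^sup>2 * (2 * (m + 1 + B))"
  proof -
    have "2 * s * (w - A) \<le> 2 * s * (w - m)" using A(1) s by (intro mult_left_mono) auto
    then show ?thesis using A(2) remainder by linarith
  qed
  finally have "s * (2 * (m - w)) \<le> s * (s * (3 + 2 * B + 2 * m))"
    by (simp add: power2_eq_square algebra_simps)
  then have "2 * (m - w) \<le> s * (3 + 2 * B + 2 * m)" using s by simp
  then show ?thesis by (simp add: m_def w_def)
qed

lemma (in gaussian_family) near_minimiser_obtains:
  assumes K: "K \<subseteq> T" "K \<noteq> {}" and bound: "\<forall>t\<in>K. second_moment M (X t) \<le> B" and \<epsilon>: "0 < \<epsilon>"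
  obtains Y where "convex_comb X K Y" "second_moment M Y < least_variance M X K + \<epsilon>"
    "\<forall>t\<in>K. least_variance M X K - \<epsilon> < w_H M X Y t"
proof -
  define m where "m = least_variance M X K"
  define C where "C = 3 + 2 * B + 2 * m"
  have "0 \<le> m" unfolding m_def using K by (intro least_variance_ge) auto
  moreover have "0 \<le> B"
  proof -
    obtain t where "t \<in> K" using K by auto
    have "0 \<le> second_moment M (X t)" by simp
    with bspec[OF bound \<open>t \<in> K\<close>] show ?thesis by linarith
  qed
  ultimately have C: "3 \<le> C" by (simp add: C_def)
  define s where "s = min 1 (\<epsilon> / C)"
  have s: "0 < s" "s \<le> 1" "s * C \<le> \<epsilon>"
    using \<epsilon> C by (auto simp: s_def min_def field_simps)
  have "s\<^sup>2 \<le> s * C"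
    unfolding power2_eq_square using s C by (intro mult_left_mono) auto
  moreover obtain Y where Y: "convex_comb X K Y" "second_moment M Y < m + s\<^sup>2"
    using least_variance_lessD[OF K(2), of M X "m + s\<^sup>2"] s by (auto simp: m_def)
  ultimately have "second_moment M Y < m + \<epsilon>" using s(3) by simp
  moreover have "\<forall>t\<in>K. m - \<epsilon> < w_H M X Y t"
  proof
    fix t assume t: "t \<in> K"
    have "m - s * C / 2 \<le> w_H M X Y t"
      using near_minimiser_first_order[OF K(1) t bspec[OF bound t] Y(1) _ s(1,2)] Y(2)
      by (simp add: m_def C_def)
    then show "m - \<epsilon> < w_H M X Y t" using s(3) \<epsilon> by simp
  qed
  ultimately show thesis using that Y(1) by (simp add: m_def)
qed

lemma (in gaussian_family) admissible_lin_comb_obtains: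
  assumes K: "K \<subseteq> T" "K \<noteq> {}" and bound: "\<forall>t\<in>K. second_moment M (X t) \<le> B"
    and m: "0 < least_variance M X K" and q: "1 / least_variance M X K < q"
  obtains H where "lin_comb X K H" "\<forall>t\<in>K. 1 < w_H M X H t" "second_moment M H < q"
proof -
  let ?m = "least_variance M X K"
  have "((\<lambda>\<epsilon>. (?m + \<epsilon>) / (?m - \<epsilon>)\<^sup>2) \<longlongrightarrow> (?m + 0) / (?m - 0)\<^sup>2) (at_right 0)"
    using m by (intro tendsto_intros) auto
  then obtain \<epsilon> where \<epsilon>: "(?m + \<epsilon>) / (?m - \<epsilon>)\<^sup>2 < q" "0 < \<epsilon>" "\<epsilon> < ?m"
    by (rule tendsto_at_right_less_obtains[where k = q and e = ?m])
      (use q m in \<open>auto simp: power2_eq_square\<close>)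
  obtain Y where Y: "convex_comb X K Y" "second_moment M Y < ?m + \<epsilon>" "\<forall>t\<in>K. ?m - \<epsilon> < w_H M X Y t"
    by (rule near_minimiser_obtains[OF K bound \<epsilon>(2)])
  define H where "H = (\<lambda>x. 1 / (?m - \<epsilon>) * Y x)"
  show thesis
  proof (rule that)
    show "lin_comb X K H" unfolding H_def by (intro lin_comb_scale convex_comb_imp_lin_comb Y(1))
    show "\<forall>t\<in>K. 1 < w_H M X H t"
    proof
      fix t assume "t \<in> K"
      have "w_H M X H t = w_H M X Y t / (?m - \<epsilon>)" by (simp add: w_H_def H_def)
      then show "1 < w_H M X H t" using Y(3) \<open>t \<in> K\<close> \<epsilon>(3) by simp
    qed
    have "second_moment M H = second_moment M Y / (?m - \<epsilon>)\<^sup>2" by (simp add: H_def power_divide)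
    also have "\<dots> < (?m + \<epsilon>) / (?m - \<epsilon>)\<^sup>2" using Y(2) \<epsilon>(3) by (intro divide_strict_right_mono) auto
    finally show "second_moment M H < q" using \<epsilon>(1) by simp
  qed
qed

text \<open>The family \<open>\<phi>\<close> may be \<open>X\<close> itself or the characters in \<open>L\<^sup>2(F)\<close> for a spectral measure \<open>F\<close>.\<close>

lemma least_variance_ge_of_dual:
  fixes \<phi> :: "'d \<Rightarrow> 'b \<Rightarrow> 'c::euclidean_space"
  assumes K: "K \<noteq> {}" and X: "\<And>t. t \<in> K \<Longrightarrow> square_integrable M (X t)"
    and \<phi>: "\<And>t. t \<in> K \<Longrightarrow> square_integrable N (\<phi> t)"
    and gram: "\<And>s t. s \<in> K \<Longrightarrow> t \<in> K \<Longrightarrow> (\<integral>x. \<phi> s x \<bullet> \<phi> t x \<partial>N) = (\<integral>x. X s x * X t x \<partial>M)"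
    and h: "square_integrable N h" "\<And>t. t \<in> K \<Longrightarrow> 1 \<le> (\<integral>x. \<phi> t x \<bullet> h x \<partial>N)" "(\<integral>x. (norm (h x))\<^sup>2 \<partial>N) \<le> q"
  shows "1 / q \<le> least_variance M X K"
proof (rule least_variance_ge[OF K])
  fix Y assume "convex_comb X K Y"
  then obtain S c where "finite S" and S: "S \<subseteq> K" "\<forall>t\<in>S. 0 \<le> c t" "(\<Sum>t\<in>S. c t) = 1"
    and Y: "Y = (\<lambda>x. \<Sum>t\<in>S. c t * X t x)"
    by (rule convex_comb_obtains)
  define g where "g = (\<lambda>x. \<Sum>t\<in>S. c t *\<^sub>R \<phi> t x)"
  have g: "square_integrable N g"
    unfolding g_def using S \<phi> by (intro square_integrable_sum_scaleR) auto
  have "(\<integral>x. g x \<bullet> h x \<partial>N) = (\<Sum>t\<in>S. c t * (\<integral>x. \<phi> t x \<bullet> h x \<partial>N))"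
    using integrable_inner[OF \<phi> h(1)] S(1) by (simp add: g_def inner_sum_left subset_eq)
  also have "1 \<le> \<dots>" using S h(2) by (intro le_convex_sum) auto
  finally have "1 \<le> (\<integral>x. g x \<bullet> h x \<partial>N)" .
  then have "1\<^sup>2 \<le> (\<integral>x. g x \<bullet> h x \<partial>N)\<^sup>2" by (intro power_mono) auto
  also have "\<dots> \<le> (\<integral>x. (norm (g x))\<^sup>2 \<partial>N) * (\<integral>x. (norm (h x))\<^sup>2 \<partial>N)"
    by (rule Cauchy_Schwarz_integral[OF g h(1)])
  also have "(\<integral>x. (norm (g x))\<^sup>2 \<partial>N) = second_moment M Y"
    using integral_norm_sum_square[of S N \<phi> c] integral_norm_sum_square[of S M X c] S(1) \<phi> X gram
    by (simp add: g_def Y subset_eq)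
  also have "second_moment M Y * (\<integral>x. (norm (h x))\<^sup>2 \<partial>N) \<le> second_moment M Y * q"
    using h(3) by (intro mult_left_mono) auto
  finally have "1 \<le> second_moment M Y * q" by simp
  moreover have "0 \<le> second_moment M Y" by simp
  ultimately have "0 < q" by (metis linorder_not_less mult_nonneg_nonpos not_one_le_zero order_trans)
  with \<open>1 \<le> second_moment M Y * q\<close> show "1 / q \<le> second_moment M Y"
    by (simp add: pos_divide_le_eq)
qed

lemma least_variance_separated:
  assumes X: "\<And>t. t \<in> S \<Longrightarrow> square_integrable M (X t)" and S: "finite S" "S \<noteq> {}" "S \<subseteq> K"
    and diag: "\<And>t. t \<in> S \<Longrightarrow> second_moment M (X t) \<le> v" and \<epsilon>: "0 \<le> \<epsilon>"
    and offdiag: "\<And>s t. s \<in> S \<Longrightarrow> t \<in> S \<Longrightarrow> s \<noteq> t \<Longrightarrow> (\<integral>x. X s x * X t x \<partial>M) \<le> \<epsilon>"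
  shows "least_variance M X K \<le> v / card S + \<epsilon>"
proof -
  let ?n = "real (card S)"
  have n: "0 < ?n" using S by (simp add: card_gt_0_iff)
  have "convex_comb X K (\<lambda>x. \<Sum>t\<in>S. 1 / ?n * X t x)"
    unfolding convex_comb_def using S n by (intro exI[of _ S] exI[of _ "\<lambda>_. 1 / ?n"]) auto
  then have "least_variance M X K \<le> second_moment M (\<lambda>x. \<Sum>t\<in>S. 1 / ?n * X t x)"
    by (rule least_variance_le)
  also have "\<dots> = (\<Sum>s\<in>S. \<Sum>t\<in>S. 1 / ?n * (1 / ?n) * (\<integral>x. X s x * X t x \<partial>M))"
    using integral_norm_sum_square[of S M X "\<lambda>_. 1 / ?n"] X by simp
  also have "\<dots> \<le> (\<Sum>s\<in>S. \<Sum>t\<in>S. 1 / ?n * (1 / ?n) * ((if s = t then v else 0) + \<epsilon>))"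
    using diag offdiag \<epsilon>
    by (intro sum_mono mult_left_mono) (auto simp: power2_eq_square intro: add_increasing2)
  also have "\<dots> = 1 / ?n * (1 / ?n) * (\<Sum>s\<in>S. \<Sum>t\<in>S. (if s = t then v else 0) + \<epsilon>)"
    by (simp only: sum_distrib_left)
  also have "(\<Sum>s\<in>S. \<Sum>t\<in>S. (if s = t then v else 0) + \<epsilon>) = ?n * (v + ?n * \<epsilon>)"
    using S(1) by (simp add: sum.distrib)
  also have "1 / ?n * (1 / ?n) * (?n * (v + ?n * \<epsilon>)) = v / ?n + \<epsilon>"
    using n by (simp add: field_simps)
  finally show ?thesis .
qed

section \<open>Gaussian fields with continuous paths\<close>

definition close_pairs :: "'d::metric_space set \<Rightarrow> real \<Rightarrow> ('d \<times> 'd) set" where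
  "close_pairs D \<delta> = {(a, b). a \<in> D \<and> b \<in> D \<and> dist a b < \<delta>}"

lemma countable_close_pairs: "countable D \<Longrightarrow> countable (close_pairs D \<delta>)"
  by (rule countable_subset[of _ "D \<times> D"]) (auto simp: close_pairs_def)

lemma dense_close_pairs_bound:
  fixes f :: "'d::metric_space \<Rightarrow> real"
  assumes f: "continuous_on S f" and D: "D \<subseteq> S" "S \<subseteq> closure D"
    and bound: "\<forall>(a, b)\<in>close_pairs D \<delta>. \<bar>f a - f b\<bar> \<le> r"
    and st: "s \<in> S" "t \<in> S" "dist s t < \<delta>"
  shows "\<bar>f s - f t\<bar> \<le> r"
proof -
  obtain a where a: "\<And>n. a n \<in> D" "a \<longlonglongrightarrow> s"
    using subsetD[OF D(2) st(1)] unfolding closure_sequential by blast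
  obtain b where b: "\<And>n. b n \<in> D" "b \<longlonglongrightarrow> t"
    using subsetD[OF D(2) st(2)] unfolding closure_sequential by blast
  have "(\<lambda>n. f (a n)) \<longlonglongrightarrow> f s"
    using a D by (intro continuous_on_tendsto_compose[OF f a(2) st(1)] always_eventually) auto
  moreover have "(\<lambda>n. f (b n)) \<longlonglongrightarrow> f t"
    using b D by (intro continuous_on_tendsto_compose[OF f b(2) st(2)] always_eventually) auto
  ultimately have "(\<lambda>n. \<bar>f (a n) - f (b n)\<bar>) \<longlonglongrightarrow> \<bar>f s - f t\<bar>"
    by (intro tendsto_intros)
  moreover have "\<forall>\<^sub>F n in sequentially. \<bar>f (a n) - f (b n)\<bar> \<le> r"
  proof -
    have "(\<lambda>n. dist (a n) (b n)) \<longlonglongrightarrow> dist s t" using a b by (intro tendsto_intros)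
    then have "\<forall>\<^sub>F n in sequentially. dist (a n) (b n) < \<delta>" using st(3) by (rule order_tendstoD)
    then show ?thesis by eventually_elim (use bound a b in \<open>auto simp: close_pairs_def\<close>)
  qed
  ultimately show ?thesis by (intro tendsto_upperbound) auto
qed

lemma (in prob_space) prob_incseq_obtains:
  assumes "\<And>n. A n \<in> events" "incseq A" "(\<Union>n. A n) = space M" "p < 1"
  obtains n where "p < prob (A n)"
proof -
  have "range A \<subseteq> events" using assms(1) by blast
  then have "(\<lambda>n. prob (A n)) \<longlonglongrightarrow> 1"
    using finite_Lim_measure_incseq[of A] assms(2,3) by (simp add: prob_space)
  then have "\<forall>\<^sub>F n in sequentially. p < prob (A n)" using \<open>p < 1\<close> by (rule order_tendstoD)
  then show thesis using that eventually_happens'[OF sequentially_bot] by blast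
qed

lemma (in prob_space) eventually_prob_bounded:
  fixes V :: "'i \<Rightarrow> 'a \<Rightarrow> real"
  assumes I: "countable I" and [measurable]: "\<And>i. i \<in> I \<Longrightarrow> V i \<in> borel_measurable M"
    and bounded: "\<And>x. x \<in> space M \<Longrightarrow> \<exists>b. \<forall>i\<in>I. \<bar>V i x\<bar> \<le> b" and p: "p < 1"
  shows "\<forall>\<^sub>F r in at_top. p < prob {x\<in>space M. \<forall>i\<in>I. \<bar>V i x\<bar> \<le> r}"
proof -
  let ?A = "\<lambda>r. {x\<in>space M. \<forall>i\<in>I. \<bar>V i x\<bar> \<le> r}"
  have events: "?A r \<in> events" for r using I by measurable
  have mono: "?A r \<subseteq> ?A r'" if "r \<le> r'" for r r' using that by (auto intro: order_trans)
  have "(\<Union>n. ?A (real n)) = space M"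
  proof -
    have "\<exists>n. \<forall>i\<in>I. \<bar>V i x\<bar> \<le> real n" if "x \<in> space M" for x
      using bounded[OF that] real_arch_simple by (meson order_trans)
    then show ?thesis by auto
  qed
  then obtain n where n: "p < prob (?A (real n))"
    using prob_incseq_obtains[of "\<lambda>n. ?A (real n)" p] events mono p by (auto simp: incseq_def)
  show ?thesis
    using eventually_ge_at_top[of "real n"]
  proof eventually_elim
    case (elim r)
    have "prob (?A (real n)) \<le> prob (?A r)" using mono[OF elim] events by (rule finite_measure_mono)
    then show ?case using n by simp
  qed
qed

locale gaussian_field = gaussian_family M X T
  for M :: "'a measure" and X :: "'d::{metric_space,second_countable_topology} \<Rightarrow> 'a \<Rightarrow> real" and T +
  assumes continuous: "continuous_paths M X T"
begin

lemma continuous_sample: "x \<in> space M \<Longrightarrow> K \<subseteq> T \<Longrightarrow> continuous_on K (\<lambda>t. X t x)"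
  using continuous unfolding continuous_paths_def by (auto intro: continuous_on_subset)

lemma sample_bounded:
  assumes "x \<in> space M" "compact K" "K \<subseteq> T"
  obtains b where "\<forall>t\<in>K. \<bar>X t x\<bar> \<le> b"
proof -
  have "bounded ((\<lambda>t. X t x) ` K)"
    using assms by (intro compact_imp_bounded compact_continuous_image continuous_sample)
  then show thesis using that by (auto simp: bounded_iff)
qed

text \<open>Along a convergent sequence of indices the characteristic functions \<open>exp (- E (X t)\<^sup>2 / 2)\<close>
  converge by dominated convergence.\<close>

lemma continuous_on_second_moment: "continuous_on T (\<lambda>t. second_moment M (X t))"
  unfolding continuous_on_sequentially comp_def
proof (intro allI ballI impI, elim conjE)
  fix t a assume t: "\<forall>n::nat. t n \<in> T" "t \<longlonglongrightarrow> a" and a: "a \<in> T"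
  have [measurable]: "X (t n) \<in> borel_measurable M" "X a \<in> borel_measurable M" for n
    using t(1) a by (auto intro: point_measurable)
  have "(\<lambda>n. X (t n) x) \<longlonglongrightarrow> X a x" if "x \<in> space M" for x
    using continuous_on_tendsto_compose[OF continuous_sample[OF that order_refl] t(2) a] t(1) by simp
  then have "(\<lambda>n. \<integral>x. iexp (X (t n) x) \<partial>M) \<longlonglongrightarrow> (\<integral>x. iexp (X a x) \<partial>M)"
    by (intro integral_dominated_convergence[where w = "\<lambda>_. 1"])
      (auto intro!: AE_I2 tendsto_intros)
  then have "(\<lambda>n. exp (- second_moment M (X (t n)) / 2)) \<longlonglongrightarrow> exp (- second_moment M (X a) / 2)"
    using t(1) a by (simp add: lin_comb_charfun lin_comb_point tendsto_of_real_iff)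
  from tendsto_ln[OF this] have "(\<lambda>n. - second_moment M (X (t n)) / 2) \<longlonglongrightarrow> - second_moment M (X a) / 2"
    by simp
  from tendsto_mult_left[OF this, of "- 2"]
  show "(\<lambda>n. second_moment M (X (t n))) \<longlonglongrightarrow> second_moment M (X a)" by simp
qed

lemma second_moment_bounded:
  assumes "compact K" "K \<subseteq> T"
  obtains B where "\<forall>t\<in>K. second_moment M (X t) \<le> B"
proof -
  have "bounded ((\<lambda>t. second_moment M (X t)) ` K)"
    using assms by (intro compact_imp_bounded compact_continuous_image
        continuous_on_subset[OF continuous_on_second_moment])
  then show thesis using that by (auto simp: bounded_iff dest: abs_le_D1)
qed

lemma close_pairs_events:
  assumes "countable D" "D \<subseteq> T"
  shows "{x\<in>space M. \<forall>(a, b)\<in>close_pairs D \<delta>. \<bar>X a x - X b x\<bar> \<le> r} \<in> events"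
    and "{x\<in>space M. \<exists>(a, b)\<in>close_pairs D \<delta>. r < \<bar>X a x - X b x\<bar>} \<in> events"
proof -
  have [measurable]: "X (fst z) \<in> borel_measurable M" "X (snd z) \<in> borel_measurable M"
    if "z \<in> close_pairs D \<delta>" for z
    using that assms(2) by (auto simp: close_pairs_def intro!: point_measurable)
  show "{x\<in>space M. \<forall>(a, b)\<in>close_pairs D \<delta>. \<bar>X a x - X b x\<bar> \<le> r} \<in> events"
    "{x\<in>space M. \<exists>(a, b)\<in>close_pairs D \<delta>. r < \<bar>X a x - X b x\<bar>} \<in> events"
    using countable_close_pairs[OF assms(1)] unfolding case_prod_unfold by measurable
qed

lemma prob_close_pairs_le_obtains:
  assumes S: "compact S" "S \<subseteq> T" and D: "countable D" "D \<subseteq> S" and s: "0 < s" and p: "p < 1"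
  obtains \<delta> where "0 < \<delta>" "p < prob {x\<in>space M. \<forall>(a, b)\<in>close_pairs D \<delta>. \<bar>X a x - X b x\<bar> \<le> s}"
proof -
  let ?A = "\<lambda>n. {x\<in>space M. \<forall>(a, b)\<in>close_pairs D (1 / real (Suc n)). \<bar>X a x - X b x\<bar> \<le> s}"
  have "?A n \<in> events" for n
    using D(1) order_trans[OF D(2) S(2)] by (rule close_pairs_events)
  moreover have "incseq ?A"
  proof (rule incseq_SucI)
    fix n
    have "1 / real (Suc (Suc n)) \<le> 1 / real (Suc n)" by (intro divide_left_mono) auto
    then have "close_pairs D (1 / real (Suc (Suc n))) \<subseteq> close_pairs D (1 / real (Suc n))"
      by (auto simp: close_pairs_def)
    then show "?A n \<subseteq> ?A (Suc n)" by blast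
  qed
  moreover have "(\<Union>n. ?A n) = space M"
  proof -
    have "x \<in> (\<Union>n. ?A n)" if x: "x \<in> space M" for x
    proof -
      have "uniformly_continuous_on S (\<lambda>t. X t x)"
        using continuous_sample[OF x S(2)] S(1) by (rule compact_uniformly_continuous)
      then obtain e where e: "0 < e" "\<And>a b. a \<in> S \<Longrightarrow> b \<in> S \<Longrightarrow> dist b a < e \<Longrightarrow> dist (X b x) (X a x) < s"
        using s unfolding uniformly_continuous_on_def by metis
      obtain n where "1 / real (Suc n) < e" using e(1) nat_approx_posE by metis
      then have "\<bar>X a x - X b x\<bar> \<le> s" if "(a, b) \<in> close_pairs D (1 / real (Suc n))" for a b
        using that e(2)[of b a] D(2)
        by (auto simp: close_pairs_def dist_real_def subset_eq intro!: less_imp_le)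
      then show ?thesis using x by blast
    qed
    then show ?thesis by blast
  qed
  ultimately obtain n where "p < prob (?A n)"
    using p by (rule prob_incseq_obtains)
  then show thesis using that[of "1 / real (Suc n)"] by simp
qed

lemma prob_close_pairs_gt_le:
  assumes D: "countable D" "D \<subseteq> T" and s: "0 < s" "4 * s \<le> r"
    and three_quarters: "3 / 4 \<le> prob {x\<in>space M. \<forall>(a, b)\<in>close_pairs D \<delta>. \<bar>X a x - X b x\<bar> \<le> s}"
  shows "prob {x\<in>space M. \<exists>(a, b)\<in>close_pairs D \<delta>. r < \<bar>X a x - X b x\<bar>} \<le> exp (- r\<^sup>2 / (32 * s\<^sup>2))"
  unfolding case_prod_unfold
proof (rule fernique)
  show "lin_comb X T (\<lambda>x. X (fst z) x - X (snd z) x)" if "z \<in> close_pairs D \<delta>" for z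
    using that D(2) by (auto simp: close_pairs_def intro!: lin_comb_diff lin_comb_point)
qed (use D s three_quarters in \<open>simp_all add: countable_close_pairs case_prod_unfold\<close>)

lemma modulus_tail_obtains:
  assumes S: "compact S" "S \<subseteq> T" and h: "0 < h" and c: "0 < c"
  obtains \<delta> where "0 < \<delta>" "\<forall>\<^sub>F u in at_top. \<exists>E\<in>events. prob E \<le> exp (- c * u\<^sup>2) \<and>
    (\<forall>x\<in>space M - E. \<forall>a\<in>S. \<forall>b\<in>S. dist a b < \<delta> \<longrightarrow> \<bar>X a x - X b x\<bar> \<le> h * u)"
proof -
  obtain D where D: "countable D" "D \<subseteq> S" "S \<subseteq> closure D" by (rule separable)
  have DT: "D \<subseteq> T" using D(2) S(2) by (rule order_trans)
  define s where "s = h / sqrt (32 * c)"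
  have s: "0 < s" "h\<^sup>2 / (32 * s\<^sup>2) = c" using h c by (auto simp: s_def power_divide)
  obtain \<delta> where \<delta>: "0 < \<delta>"
    and three_quarters: "3 / 4 < prob {x\<in>space M. \<forall>(a, b)\<in>close_pairs D \<delta>. \<bar>X a x - X b x\<bar> \<le> s}"
    by (rule prob_close_pairs_le_obtains[OF S D(1,2) s(1), of "3 / 4"]) simp
  have "\<forall>\<^sub>F u in at_top. \<exists>E\<in>events. prob E \<le> exp (- c * u\<^sup>2) \<and>
      (\<forall>x\<in>space M - E. \<forall>a\<in>S. \<forall>b\<in>S. dist a b < \<delta> \<longrightarrow> \<bar>X a x - X b x\<bar> \<le> h * u)"
    using eventually_ge_at_top[of "4 * s / h"]
  proof eventually_elim
    case (elim u)
    let ?E = "{x\<in>space M. \<exists>(a, b)\<in>close_pairs D \<delta>. h * u < \<bar>X a x - X b x\<bar>}"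
    have "?E \<in> events"
      using D(1) DT by (rule close_pairs_events)
    moreover have "prob ?E \<le> exp (- c * u\<^sup>2)"
    proof -
      have "prob ?E \<le> exp (- (h * u)\<^sup>2 / (32 * s\<^sup>2))"
        using elim h three_quarters by (intro prob_close_pairs_gt_le D(1) DT s(1)) (simp_all add: field_simps)
      also have "- (h * u)\<^sup>2 / (32 * s\<^sup>2) = - c * u\<^sup>2"
        unfolding s(2)[symmetric] by (simp add: power_mult_distrib)
      finally show ?thesis .
    qed
    moreover have "\<bar>X a x - X b x\<bar> \<le> h * u"
      if x: "x \<in> space M - ?E" and ab: "a \<in> S" "b \<in> S" "dist a b < \<delta>" for x a b
    proof (rule dense_close_pairs_bound[OF continuous_sample[OF _ S(2)] D(2,3) _ ab])
      show "\<forall>(a, b)\<in>close_pairs D \<delta>. \<bar>X a x - X b x\<bar> \<le> h * u"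
        using x by (force simp: not_less)
    qed (use x in simp)
    ultimately show ?case by blast
  qed
  with \<delta> show thesis by (rule that)
qed

end

section \<open>Excursion probabilities\<close>

lemma outer_prob_le: "A \<subseteq> E \<Longrightarrow> E \<in> sets M \<Longrightarrow> outer_prob M A \<le> measure M E"
  unfolding outer_prob_def by (intro cINF_lower bdd_belowI[of _ 0]) auto

lemma outer_prob_le_add:
  assumes "A \<subseteq> E \<union> B" "B \<subseteq> E'" "E \<in> sets M" "E' \<in> sets M"
  shows "outer_prob M A \<le> measure M E + measure M E'"
proof -
  have "outer_prob M A \<le> measure M (E \<union> E')"
    using assms by (intro outer_prob_le) auto
  also have "\<dots> \<le> measure M E + measure M E'"
    using assms(3,4) by (rule measure_Un_le)
  finally show ?thesis .
qed

lemma (in finite_measure) outer_prob_ge: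
  assumes "E \<subseteq> A" "E \<in> sets M" "A \<subseteq> space M"
  shows "measure M E \<le> outer_prob M A"
  unfolding outer_prob_def using assms by (intro cINF_greatest finite_measure_mono) auto

lemma (in finite_measure) outer_prob_mono:
  assumes "A \<subseteq> B" "B \<subseteq> space M"
  shows "outer_prob M A \<le> outer_prob M B"
  unfolding outer_prob_def[of M B]
  using assms outer_prob_le[of A _ M] by (intro cINF_greatest) auto

definition excursion :: "'a measure \<Rightarrow> ('d \<Rightarrow> 'a \<Rightarrow> real) \<Rightarrow> 'd set set \<Rightarrow> real \<Rightarrow> 'a set" where
  "excursion M X \<K> u = {x\<in>space M. \<exists>K\<in>\<K>. \<forall>t\<in>K. u < X t x}"

lemma excursion_subset_space: "excursion M X \<K> u \<subseteq> space M"
  by (auto simp: excursion_def)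

lemma excursion_mono:
  assumes "\<And>K. K \<in> \<K> \<Longrightarrow> \<exists>L\<in>\<L>. L \<subseteq> K"
  shows "excursion M X \<K> u \<subseteq> excursion M X \<L> u"
proof
  fix x assume "x \<in> excursion M X \<K> u"
  then obtain K where "x \<in> space M" "K \<in> \<K>" "\<forall>t\<in>K. u < X t x" by (auto simp: excursion_def)
  moreover obtain L where "L \<in> \<L>" "L \<subseteq> K" using assms[OF \<open>K \<in> \<K>\<close>] by blast
  ultimately show "x \<in> excursion M X \<L> u" by (auto simp: excursion_def)
qed

lemma compact_finite_representatives:
  fixes S :: "'d::metric_space set"
  assumes S: "compact S" "\<And>K. K \<in> \<K> \<Longrightarrow> K \<subseteq> S" and \<delta>: "0 < \<delta>"
  obtains \<L> where "finite \<L>" "\<L> \<subseteq> \<K>" "\<And>K. K \<in> \<K> \<Longrightarrow> \<exists>L\<in>\<L>. \<forall>t\<in>L. \<exists>k\<in>K. dist k t < \<delta>"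
proof -
  obtain N where N: "finite N" "S \<subseteq> (\<Union>y\<in>N. ball y (\<delta> / 2))"
    using S(1) \<delta> unfolding compact_eq_totally_bounded by (meson half_gt_zero)
  define trace where "trace K = {y\<in>N. K \<inter> ball y (\<delta> / 2) \<noteq> {}}" for K
  have "finite (trace ` \<K>)"
    by (rule finite_subset[of _ "Pow N"]) (use N(1) in \<open>auto simp: trace_def\<close>)
  then obtain \<L> where \<L>: "finite \<L>" "\<L> \<subseteq> \<K>" "trace ` \<K> = trace ` \<L>"
    using finite_subset_image[of "trace ` \<K>" trace \<K>] by blast
  show thesis
  proof (rule that[OF \<L>(1,2)])
    fix K assume "K \<in> \<K>"
    then obtain L where L: "L \<in> \<L>" "trace K = trace L" using \<L>(3) by blast
    have "\<exists>k\<in>K. dist k t < \<delta>" if t: "t \<in> L" for t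
    proof -
      obtain y where y: "y \<in> N" "t \<in> ball y (\<delta> / 2)" using N(2) S(2) \<L>(2) L(1) t by blast
      then have "y \<in> trace K" using t unfolding L(2) by (auto simp: trace_def)
      then obtain k where k: "k \<in> K" "k \<in> ball y (\<delta> / 2)" by (auto simp: trace_def)
      have "dist k t < \<delta>"
        using y(2) k(2) dist_triangle_half_r[of y k \<delta> t] by simp
      then show ?thesis using k(1) by blast
    qed
    then show "\<exists>L\<in>\<L>. \<forall>t\<in>L. \<exists>k\<in>K. dist k t < \<delta>" using L(1) by blast
  qed
qed

lemma (in gaussian_family) finite_excursion_bound:
  assumes \<L>: "finite \<L>" "\<And>L. L \<in> \<L> \<Longrightarrow> L \<subseteq> T \<and> L \<noteq> {} \<and> least_variance M X L < v"
    and v: "0 < v" and r: "0 < r"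
  obtains E where "E \<in> events" "excursion M X \<L> r \<subseteq> E" "prob E \<le> card \<L> * exp (- r\<^sup>2 / (2 * v))"
proof -
  have "\<forall>L\<in>\<L>. \<exists>Y. convex_comb X L Y \<and> second_moment M Y < v"
    using \<L>(2) by (intro ballI least_variance_lessD) auto
  from bchoice[OF this] obtain Y
    where Y: "\<And>L. L \<in> \<L> \<Longrightarrow> convex_comb X L (Y L)" "\<And>L. L \<in> \<L> \<Longrightarrow> second_moment M (Y L) < v"
    by blast
  have lin_Y: "lin_comb X T (Y L)" if "L \<in> \<L>" for L
    using lin_comb_mono[OF convex_comb_imp_lin_comb[OF Y(1)[OF that]]] \<L>(2)[OF that] by blast
  define E where "E L = {x\<in>space M. r \<le> Y L x}" for L
  have events: "E L \<in> events" if "L \<in> \<L>" for L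
    using lin_comb_measurable[OF lin_Y[OF that]] unfolding E_def by measurable
  show thesis
  proof (rule that)
    show "(\<Union>L\<in>\<L>. E L) \<in> events" using \<L>(1) events by (intro sets.finite_UN)
    show "excursion M X \<L> r \<subseteq> (\<Union>L\<in>\<L>. E L)"
    proof
      fix x assume "x \<in> excursion M X \<L> r"
      then obtain L where L: "x \<in> space M" "L \<in> \<L>" "\<forall>t\<in>L. r < X t x" by (auto simp: excursion_def)
      have "r \<le> Y L x"
        by (rule convex_comb_ge[OF Y(1)[OF L(2)]]) (use L(3) in \<open>simp add: less_imp_le\<close>)
      then show "x \<in> (\<Union>L\<in>\<L>. E L)" using L by (auto simp: E_def)
    qed
    have "prob (E L) \<le> exp (- r\<^sup>2 / (2 * v))" if "L \<in> \<L>" for L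
      unfolding E_def using lin_comb_normal[OF lin_Y[OF that]] Y(2)[OF that] v r
      by (intro centered_normal_upper_tail) auto
    then have "(\<Sum>L\<in>\<L>. prob (E L)) \<le> card \<L> * exp (- r\<^sup>2 / (2 * v))"
      by (rule sum_bounded_above)
    moreover have "prob (\<Union>L\<in>\<L>. E L) \<le> (\<Sum>L\<in>\<L>. prob (E L))"
      using \<L>(1) events by (intro measure_UNION_le)
    ultimately show "prob (\<Union>L\<in>\<L>. E L) \<le> card \<L> * exp (- r\<^sup>2 / (2 * v))"
      by (rule order_trans[rotated])
  qed
qed

context gaussian_field
begin

lemma excursion_finite_reduction:
  assumes S: "compact S" "S \<subseteq> T" "\<And>K. K \<in> \<K> \<Longrightarrow> K \<subseteq> S" and h: "0 < h" and c: "0 < c"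
  obtains \<L> where "finite \<L>" "\<L> \<subseteq> \<K>"
    "\<forall>\<^sub>F u in at_top. \<exists>E\<in>events. prob E \<le> exp (- c * u\<^sup>2) \<and>
      excursion M X \<K> u \<subseteq> E \<union> excursion M X \<L> ((1 - h) * u)"
proof -
  obtain \<delta> where "0 < \<delta>" and modulus: "\<forall>\<^sub>F u in at_top. \<exists>E\<in>events. prob E \<le> exp (- c * u\<^sup>2) \<and>
      (\<forall>x\<in>space M - E. \<forall>a\<in>S. \<forall>b\<in>S. dist a b < \<delta> \<longrightarrow> \<bar>X a x - X b x\<bar> \<le> h * u)"
    using S(1,2) h c by (rule modulus_tail_obtains)
  obtain \<L> where \<L>: "finite \<L>" "\<L> \<subseteq> \<K>" "\<And>K. K \<in> \<K> \<Longrightarrow> \<exists>L\<in>\<L>. \<forall>t\<in>L. \<exists>k\<in>K. dist k t < \<delta>"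
    using compact_finite_representatives[OF S(1,3) \<open>0 < \<delta>\<close>] by blast
  have cover: "excursion M X \<K> u \<subseteq> E \<union> excursion M X \<L> ((1 - h) * u)"
    if E: "\<forall>x\<in>space M - E. \<forall>a\<in>S. \<forall>b\<in>S. dist a b < \<delta> \<longrightarrow> \<bar>X a x - X b x\<bar> \<le> h * u" for u E
  proof
    fix x assume "x \<in> excursion M X \<K> u"
    then obtain K where K: "x \<in> space M" "K \<in> \<K>" "\<forall>t\<in>K. u < X t x" by (auto simp: excursion_def)
    obtain L where L: "L \<in> \<L>" "\<forall>t\<in>L. \<exists>k\<in>K. dist k t < \<delta>" using \<L>(3)[OF K(2)] by blast
    have "(1 - h) * u < X t x" if x: "x \<notin> E" and t: "t \<in> L" for t
    proof -
      obtain k where k: "k \<in> K" "dist k t < \<delta>" using L(2) t by blast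
      have "k \<in> S" "t \<in> S" using S(3) K(2) k(1) L(1) \<L>(2) t by auto
      then have "\<bar>X k x - X t x\<bar> \<le> h * u" using E x K(1) k(2) by blast
      moreover have "u < X k x" using K(3) k(1) by blast
      ultimately show ?thesis by (simp add: algebra_simps)
    qed
    then show "x \<in> E \<union> excursion M X \<L> ((1 - h) * u)"
      using K(1) L(1) by (auto simp: excursion_def)
  qed
  from modulus have "\<forall>\<^sub>F u in at_top. \<exists>E\<in>events. prob E \<le> exp (- c * u\<^sup>2) \<and>
      excursion M X \<K> u \<subseteq> E \<union> excursion M X \<L> ((1 - h) * u)"
  proof eventually_elim
    case (elim u)
    then obtain E where "E \<in> events" "prob E \<le> exp (- c * u\<^sup>2)"
      "\<forall>x\<in>space M - E. \<forall>a\<in>S. \<forall>b\<in>S. dist a b < \<delta> \<longrightarrow> \<bar>X a x - X b x\<bar> \<le> h * u" by blast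
    with cover show ?case by meson
  qed
  with \<L>(1,2) show thesis by (rule that)
qed

lemma outer_prob_excursion_le_of_slack:
  assumes S: "compact S" "S \<subseteq> T"
    and \<K>: "\<And>K. K \<in> \<K> \<Longrightarrow> K \<subseteq> S \<and> K \<noteq> {} \<and> least_variance M X K \<le> v"
    and v: "0 < v" and c: "0 < c" and h: "0 < h" "h < 1" "(c + h) * (v + h) \<le> (1 - h)\<^sup>2"
  shows "\<forall>\<^sub>F u in at_top. outer_prob M (excursion M X \<K> u) \<le> exp (- c * u\<^sup>2 / 2)"
proof -
  define c' where "c' = (c + h) / 2"
  have "0 < c'" using c h(1) by (simp add: c'_def)
  have "c' \<le> (1 - h)\<^sup>2 / (2 * (v + h))" using h(1,3) v by (simp add: c'_def field_simps)
  then have tail: "exp (- ((1 - h) * u)\<^sup>2 / (2 * (v + h))) \<le> exp (- c' * u\<^sup>2)" for u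
    using mult_right_mono[of c' "(1 - h)\<^sup>2 / (2 * (v + h))" "u\<^sup>2"] by (simp add: power_mult_distrib)
  obtain \<L> where \<L>: "finite \<L>" "\<L> \<subseteq> \<K>" and reduction: "\<forall>\<^sub>F u in at_top. \<exists>E\<in>events.
      prob E \<le> exp (- c' * u\<^sup>2) \<and> excursion M X \<K> u \<subseteq> E \<union> excursion M X \<L> ((1 - h) * u)"
    by (rule excursion_finite_reduction[OF S _ h(1) \<open>0 < c'\<close>, of \<K>]) (use \<K> in blast)+
  have least: "L \<subseteq> T \<and> L \<noteq> {} \<and> least_variance M X L < v + h" if "L \<in> \<L>" for L
  proof -
    have "L \<in> \<K>" using that \<L>(2) by blast
    from \<K>[OF this] show ?thesis using S(2) h(1) by (auto simp: subset_eq)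
  qed
  have "\<forall>\<^sub>F u in at_top. 1 + real (card \<L>) \<le> exp (h / 2 * u\<^sup>2 + 0 * u + 0)"
    using h(1) by (intro eventually_le_exp_quadratic) simp
  with reduction show ?thesis
    using eventually_gt_at_top[of 0]
  proof eventually_elim
    case (elim u)
    obtain E where E: "E \<in> events" "prob E \<le> exp (- c' * u\<^sup>2)"
      "excursion M X \<K> u \<subseteq> E \<union> excursion M X \<L> ((1 - h) * u)"
      using elim(1) by blast
    have "0 < v + h" "0 < (1 - h) * u" using elim(3) h(1,2) v by simp_all
    with \<L>(1) least obtain E' where E': "E' \<in> events" "excursion M X \<L> ((1 - h) * u) \<subseteq> E'"
      "prob E' \<le> card \<L> * exp (- ((1 - h) * u)\<^sup>2 / (2 * (v + h)))"
      by (rule finite_excursion_bound)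
    have "outer_prob M (excursion M X \<K> u) \<le> prob E + prob E'"
      using E(3) E'(2) E(1) E'(1) by (rule outer_prob_le_add)
    also have "\<dots> \<le> exp (- c' * u\<^sup>2) + card \<L> * exp (- c' * u\<^sup>2)"
      using E(2) order_trans[OF E'(3) mult_left_mono[OF tail]] by (intro add_mono) auto
    also have "\<dots> = (1 + real (card \<L>)) * exp (- c' * u\<^sup>2)" by (simp add: algebra_simps)
    also have "\<dots> \<le> exp (h / 2 * u\<^sup>2 + 0 * u + 0) * exp (- c' * u\<^sup>2)"
      using elim(2) by (intro mult_right_mono) auto
    also have "\<dots> = exp (- c * u\<^sup>2 / 2)"
      unfolding exp_add[symmetric] by (simp add: c'_def field_simps)
    finally show ?case .
  qed
qed

lemma outer_prob_excursion_le:
  assumes S: "compact S" "S \<subseteq> T"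
    and \<K>: "\<And>K. K \<in> \<K> \<Longrightarrow> K \<inter> S \<noteq> {} \<and> least_variance M X (K \<inter> S) \<le> v"
    and v: "0 < v" and c: "0 < c" "c * v < 1"
  shows "\<forall>\<^sub>F u in at_top. outer_prob M (excursion M X \<K> u) \<le> exp (- c * u\<^sup>2 / 2)"
proof -
  have "((\<lambda>h. (c + h) * (v + h) - (1 - h)\<^sup>2) \<longlongrightarrow> (c + 0) * (v + 0) - (1 - 0)\<^sup>2) (at_right (0::real))"
    by (intro tendsto_intros)
  then obtain h where h: "(c + h) * (v + h) - (1 - h)\<^sup>2 < 0" "0 < h" "h < 1"
    by (rule tendsto_at_right_less_obtains[where k = 0 and e = 1]) (use c(2) in auto)
  define \<L> where "\<L> = (\<lambda>K. K \<inter> S) ` \<K>"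
  have "\<forall>\<^sub>F u in at_top. outer_prob M (excursion M X \<L> u) \<le> exp (- c * u\<^sup>2 / 2)"
    by (rule outer_prob_excursion_le_of_slack[OF S _ v c(1) h(2,3)]) (use \<K> h(1) in \<open>auto simp: \<L>_def\<close>)
  then show ?thesis
  proof eventually_elim
    case (elim u)
    have "outer_prob M (excursion M X \<K> u) \<le> outer_prob M (excursion M X \<L> u)"
      by (intro outer_prob_mono excursion_subset_space excursion_mono) (auto simp: \<L>_def)
    with elim show ?case by simp
  qed
qed

end

definition residual :: "'a measure \<Rightarrow> ('d \<Rightarrow> 'a \<Rightarrow> real) \<Rightarrow> ('a \<Rightarrow> real) \<Rightarrow> 'd \<Rightarrow> 'a \<Rightarrow> real" where
  "residual M X H t x = X t x - w_H M X H t / second_moment M H * H x"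

lemma (in gaussian_family) w_H_square_le:
  assumes "t \<in> T" "lin_comb X T H"
  shows "(w_H M X H t)\<^sup>2 \<le> second_moment M (X t) * second_moment M H"
  using Cauchy_Schwarz_integral[OF point_square_integrable lin_comb_square_integrable, OF assms]
  by (simp add: w_H_def)

lemma (in gaussian_family) second_moment_pos_of_w_H:
  assumes "t \<in> T" "lin_comb X T H" "1 \<le> w_H M X H t"
  shows "0 < second_moment M H"
proof -
  have "1\<^sup>2 \<le> (w_H M X H t)\<^sup>2" using assms(3) by (intro power_mono) auto
  also have "\<dots> \<le> second_moment M (X t) * second_moment M H"
    using assms(1,2) by (rule w_H_square_le)
  finally have "second_moment M H \<noteq> 0" by auto
  moreover have "0 \<le> second_moment M H" by simp
  ultimately show ?thesis by (metis less_le)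
qed

lemma (in gaussian_family) lin_comb_residual:
  assumes "t \<in> T" "lin_comb X T H"
  shows "lin_comb X T (residual M X H t)"
  unfolding residual_def using assms by (intro lin_comb_diff lin_comb_scale lin_comb_point)

lemma (in gaussian_family) residual_uncorrelated:
  assumes t: "t \<in> T" and H: "lin_comb X T H" and "second_moment M H \<noteq> 0"
  shows "(\<integral>x. residual M X H t x * H x \<partial>M) = 0"
proof -
  let ?r = "w_H M X H t / second_moment M H"
  have "(\<integral>x. residual M X H t x * H x \<partial>M) = (\<integral>x. X t x * H x - ?r * (H x)\<^sup>2 \<partial>M)"
    by (simp add: residual_def left_diff_distrib power2_eq_square mult.assoc)
  also have "\<dots> = w_H M X H t - ?r * second_moment M H"
    using lin_comb_mult_integrable[OF lin_comb_point[OF t] H] lin_comb_square_integrable[OF H]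
    by (simp add: w_H_def square_integrable_real_iff)
  finally show ?thesis using assms(3) by simp
qed

context gaussian_field
begin

lemma residual_bounded:
  assumes K: "compact K" "K \<subseteq> T" and H: "lin_comb X T H" and x: "x \<in> space M"
  shows "\<exists>b. \<forall>t\<in>K. \<bar>residual M X H t x\<bar> \<le> b"
proof -
  let ?p = "second_moment M H"
  obtain B where B: "\<forall>t\<in>K. second_moment M (X t) \<le> B"
    using K by (rule second_moment_bounded)
  obtain b where b: "\<forall>t\<in>K. \<bar>X t x\<bar> \<le> b"
    using x K by (rule sample_bounded)
  have "\<bar>residual M X H t x\<bar> \<le> b + sqrt (B * ?p) / ?p * \<bar>H x\<bar>" if t: "t \<in> K" for t
  proof -
    have "(w_H M X H t)\<^sup>2 \<le> second_moment M (X t) * ?p" using K t by (intro w_H_square_le H) auto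
    also have "\<dots> \<le> B * ?p" using bspec[OF B t] by (intro mult_right_mono) auto
    finally have "\<bar>w_H M X H t\<bar> \<le> sqrt (B * ?p)" by (intro real_le_rsqrt) simp
    then have "\<bar>w_H M X H t\<bar> / ?p * \<bar>H x\<bar> \<le> sqrt (B * ?p) / ?p * \<bar>H x\<bar>"
      by (intro mult_right_mono divide_right_mono) auto
    moreover have "\<bar>residual M X H t x\<bar> \<le> \<bar>X t x\<bar> + \<bar>w_H M X H t\<bar> / ?p * \<bar>H x\<bar>"
      unfolding residual_def by (rule order_trans[OF abs_triangle_ineq4]) (simp add: abs_mult)
    ultimately show ?thesis using bspec[OF b t] by linarith
  qed
  then show ?thesis by blast
qed

lemma excursion_of_residual_bound:
  assumes D: "D \<subseteq> K" "K \<subseteq> closure D" and K: "closed K" "K \<subseteq> T" and x: "x \<in> space M"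
    and w: "\<And>t. t \<in> K \<Longrightarrow> 1 \<le> w_H M X H t" and p: "0 < second_moment M H" and h: "0 < h" and u: "0 < u"
    and Z: "\<And>t. t \<in> D \<Longrightarrow> - (h * u) \<le> residual M X H t x"
    and H: "second_moment M H * (1 + 2 * h) * u < H x"
  shows "x \<in> excursion M X {K} u"
proof -
  let ?p = "second_moment M H"
  have closure_D: "closure D = K" using D K(1) by (simp add: closure_minimal subset_antisym)
  have on_D: "(1 + h) * u \<le> X t x" if t: "t \<in> D" for t
  proof -
    have "1 \<le> w_H M X H t" using w t D(1) by blast
    then have "1 * ((1 + 2 * h) * u) \<le> w_H M X H t * ((1 + 2 * h) * u)"
      using h u by (intro mult_right_mono) auto
    also have "\<dots> = w_H M X H t / ?p * (?p * (1 + 2 * h) * u)" using p by simp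
    also have "\<dots> \<le> w_H M X H t / ?p * H x"
      using H \<open>1 \<le> w_H M X H t\<close> p by (intro mult_left_mono) auto
    finally show ?thesis using Z[OF t] by (simp add: residual_def algebra_simps)
  qed
  have "u < X t x" if t: "t \<in> K" for t
  proof -
    have "(1 + h) * u \<le> X t x"
      using continuous_sample[OF x K(2)] t on_D unfolding closure_D[symmetric]
      by (rule continuous_ge_on_closure)
    moreover have "1 * u < (1 + h) * u" using h u by (intro mult_strict_right_mono) auto
    ultimately show ?thesis by simp
  qed
  then show ?thesis using x by (simp add: excursion_def)
qed

lemma eventually_prob_residual_le:
  assumes K: "compact K" "K \<subseteq> T" and D: "countable D" "D \<subseteq> K" and H: "lin_comb X T H" and h: "0 < h"
  shows "\<forall>\<^sub>F u in at_top. 1 / 2 < prob {x\<in>space M. \<forall>t\<in>D. \<bar>residual M X H t x\<bar> \<le> h * u}"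
proof -
  have "\<forall>\<^sub>F r in at_top. 1 / 2 < prob {x\<in>space M. \<forall>t\<in>D. \<bar>residual M X H t x\<bar> \<le> r}"
  proof (intro eventually_prob_bounded D(1))
    show "\<exists>b. \<forall>t\<in>D. \<bar>residual M X H t x\<bar> \<le> b" if "x \<in> space M" for x
      using residual_bounded[OF K H that] D(2) by blast
    show "residual M X H t \<in> borel_measurable M" if "t \<in> D" for t
      using that D(2) K(2) by (intro lin_comb_measurable lin_comb_residual H) auto
  qed simp
  then show ?thesis
    by (rule eventually_compose_filterlim)
      (intro filterlim_tendsto_pos_mult_at_top[OF tendsto_const h] filterlim_ident)
qed

lemma eventually_prob_residual_ge:
  assumes K: "compact K" "K \<subseteq> T" and D: "countable D" "D \<subseteq> K" and H: "lin_comb X T H"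
    and p: "second_moment M H = p" "0 < p" and h: "0 < h" "p * (1 + 2 * h)\<^sup>2 < q"
  shows "\<forall>\<^sub>F u in at_top. exp (- q * u\<^sup>2 / 2) \<le>
    prob {x\<in>space M. (\<forall>t\<in>D. - (h * u) \<le> residual M X H t x) \<and> p * (1 + 2 * h) * u < H x}"
proof -
  have DT: "t \<in> T" if "t \<in> D" for t using that D(2) K(2) by blast
  note [measurable] = lin_comb_measurable[OF H] lin_comb_measurable[OF lin_comb_residual[OF DT H]]
  have "\<forall>\<^sub>F u in at_top. 2 * exp (- q * u\<^sup>2 / 2) \<le> prob {x\<in>space M. p * (1 + 2 * h) * u < H x}"
    using p(2) h centered_normal_lower_tail_rate[OF lin_comb_normal[OF H] p(1), of "p * (1 + 2 * h)"]
    by (simp add: power_mult_distrib power2_eq_square[of p])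
  with eventually_prob_residual_le[OF K D H h(1)] show ?thesis
  proof eventually_elim
    case (elim u)
    let ?Z = "{x\<in>space M. \<forall>t\<in>D. residual M X H t x \<in> {- (h * u)..}}"
    let ?H = "{x\<in>space M. \<forall>i\<in>{()}. H x \<in> {p * (1 + 2 * h) * u<..}}"
    have "exp (- q * u\<^sup>2 / 2) = 1 / 2 * (2 * exp (- q * u\<^sup>2 / 2))" by simp
    also have "\<dots> \<le> prob ?Z * prob ?H"
    proof (rule mult_mono)
      have "prob {x\<in>space M. \<forall>t\<in>D. \<bar>residual M X H t x\<bar> \<le> h * u} \<le> prob ?Z"
        using D(1) by (intro finite_measure_mono) (auto simp: abs_le_iff minus_le_iff)
      then show "1 / 2 \<le> prob ?Z" using elim(1) by simp
    qed (use elim(2) in auto)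
    also have "\<dots> = prob {x\<in>space M. (\<forall>t\<in>D. residual M X H t x \<in> {- (h * u)..}) \<and>
      (\<forall>i\<in>{()}. H x \<in> {p * (1 + 2 * h) * u<..})}"
    proof (rule prob_joint_uncorrelated[symmetric])
      show "lin_comb X T (residual M X H t)" if "t \<in> D" for t
        using DT[OF that] H by (rule lin_comb_residual)
      show "(\<integral>x. residual M X H t x * H x \<partial>M) = 0" if "t \<in> D" for t
        using residual_uncorrelated[OF DT[OF that] H] p by simp
    qed (use D(1) H in auto)
    finally show ?case by simp
  qed
qed

lemma outer_prob_excursion_ge:
  assumes K: "compact K" "K \<subseteq> T" "K \<noteq> {}" and H: "lin_comb X T H"
    and w: "\<And>t. t \<in> K \<Longrightarrow> 1 \<le> w_H M X H t" and q: "second_moment M H < q"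
  shows "\<forall>\<^sub>F u in at_top. exp (- q * u\<^sup>2 / 2) \<le> outer_prob M (excursion M X {K} u)"
proof -
  let ?p = "second_moment M H"
  obtain t where t: "t \<in> K" using K(3) by blast
  have p: "0 < ?p"
    using K(2) t by (intro second_moment_pos_of_w_H[OF _ H w]) auto
  obtain D where D: "countable D" "D \<subseteq> K" "K \<subseteq> closure D" by (rule separable)
  have "((\<lambda>h. ?p * (1 + 2 * h)\<^sup>2) \<longlongrightarrow> ?p * (1 + 2 * 0)\<^sup>2) (at_right 0)"
    by (intro tendsto_intros)
  then obtain h where h: "?p * (1 + 2 * h)\<^sup>2 < q" "0 < h"
    by (rule tendsto_at_right_less_obtains[where k = q and e = 1]) (use q in auto)
  have lin_residual: "lin_comb X T (residual M X H t)" if "t \<in> D" for t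
    using that D(2) K(2) by (intro lin_comb_residual H) auto
  note [measurable] = lin_comb_measurable[OF H] lin_comb_measurable[OF lin_residual]
  show ?thesis
    using eventually_prob_residual_ge[OF K(1,2) D(1,2) H refl p h(2,1)] eventually_gt_at_top[of 0]
  proof eventually_elim
    case (elim u)
    let ?E = "{x\<in>space M. (\<forall>t\<in>D. - (h * u) \<le> residual M X H t x) \<and> ?p * (1 + 2 * h) * u < H x}"
    have "?E \<subseteq> excursion M X {K} u"
      using excursion_of_residual_bound[OF D(2,3) compact_imp_closed[OF K(1)] K(2) _ w p h(2) elim(2)]
      by blast
    moreover have "?E \<in> events" using D(1) by measurable
    ultimately have "prob ?E \<le> outer_prob M (excursion M X {K} u)"
      using excursion_subset_space by (rule outer_prob_ge)
    with elim(1) show ?case by (rule order_trans)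
  qed
qed

end

section \<open>Logarithmic rates\<close>

lemma eln_le_ereal_iff: "eln x \<le> ereal y \<longleftrightarrow> x \<le> exp y"
proof (cases "0 < x")
  case True
  then have "ln x \<le> y \<longleftrightarrow> x \<le> exp y" by (metis exp_le_cancel_iff exp_ln)
  then show ?thesis using True by (simp add: eln_def)
next
  case False
  then have "x \<le> exp y" using exp_gt_zero[of y] by linarith
  then show ?thesis using False by (simp add: eln_def)
qed

lemma ereal_le_eln_iff: "ereal y \<le> eln x \<longleftrightarrow> exp y \<le> x"
proof (cases "0 < x")
  case True
  then show ?thesis by (simp add: eln_def ln_ge_iff)
next
  case False
  then have "\<not> exp y \<le> x" using exp_gt_zero[of y] by linarith
  then show ?thesis using False by (simp add: eln_def)
qed

lemma eln_rate_le_iff: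
  assumes "0 < u"
  shows "eln x / ereal (u\<^sup>2) \<le> ereal (- c / 2) \<longleftrightarrow> x \<le> exp (- c * u\<^sup>2 / 2)"
proof -
  have "eln x / ereal (u\<^sup>2) \<le> ereal (- c / 2) \<longleftrightarrow> eln x \<le> ereal (u\<^sup>2) * ereal (- c / 2)"
    using assms by (intro ereal_divide_le_pos) auto
  also have "ereal (u\<^sup>2) * ereal (- c / 2) = ereal (- c * u\<^sup>2 / 2)" by simp
  finally show ?thesis by (simp only: eln_le_ereal_iff)
qed

lemma eln_rate_ge_iff:
  assumes "0 < u"
  shows "ereal (- c / 2) \<le> eln x / ereal (u\<^sup>2) \<longleftrightarrow> exp (- c * u\<^sup>2 / 2) \<le> x"
proof -
  have "ereal (- c / 2) \<le> eln x / ereal (u\<^sup>2) \<longleftrightarrow> ereal (u\<^sup>2) * ereal (- c / 2) \<le> eln x"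
    using assms by (intro ereal_le_divide_pos) auto
  also have "ereal (u\<^sup>2) * ereal (- c / 2) = ereal (- c * u\<^sup>2 / 2)" by simp
  finally show ?thesis by (simp only: ereal_le_eln_iff)
qed

lemma eln_rate_tendsto:
  fixes C :: ereal
  assumes C: "0 \<le> C" and le_1: "\<And>u. \<Psi> u \<le> 1"
    and upper: "\<And>c. 0 < c \<Longrightarrow> ereal c < C \<Longrightarrow> \<forall>\<^sub>F u in at_top. \<Psi> u \<le> exp (- c * u\<^sup>2 / 2)"
    and lower: "\<And>q. C < ereal q \<Longrightarrow> \<forall>\<^sub>F u in at_top. exp (- q * u\<^sup>2 / 2) \<le> \<Psi> u"
  shows "((\<lambda>u. eln (\<Psi> u) / ereal (u\<^sup>2)) \<longlongrightarrow> - C / 2) at_top"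
proof (rule order_tendstoI)
  fix y assume "y < - C / 2"
  then obtain z where z: "y < ereal z" "ereal z < - C / 2" using ereal_dense2 by blast
  then have "C < ereal (- 2 * z)" using C by (cases C) auto
  from lower[OF this] eventually_gt_at_top[of 0]
  show "\<forall>\<^sub>F u in at_top. y < eln (\<Psi> u) / ereal (u\<^sup>2)"
  proof eventually_elim
    case (elim u)
    then have "ereal z \<le> eln (\<Psi> u) / ereal (u\<^sup>2)" using eln_rate_ge_iff[of u "- 2 * z"] by simp
    with z(1) show ?case by (rule less_le_trans)
  qed
next
  fix y assume "- C / 2 < y"
  then obtain z where z: "- C / 2 < ereal z" "ereal z < y" using ereal_dense2 by blast
  then have c: "ereal (- 2 * z) < C" using C by (cases C) auto
  have "\<forall>\<^sub>F u in at_top. \<Psi> u \<le> exp (z * u\<^sup>2)"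
  proof (cases "z < 0")
    case True
    then show ?thesis using upper[OF _ c] by simp
  next
    case False
    then have "1 \<le> exp (z * u\<^sup>2)" for u :: real by simp
    then show ?thesis using le_1 order_trans by (intro always_eventually allI) blast
  qed
  then show "\<forall>\<^sub>F u in at_top. eln (\<Psi> u) / ereal (u\<^sup>2) < y"
    using eventually_gt_at_top[of 0]
  proof eventually_elim
    case (elim u)
    then have "eln (\<Psi> u) / ereal (u\<^sup>2) \<le> ereal z" using eln_rate_le_iff[of u _ "- 2 * z"] by simp
    then show ?case using z(2) by (rule le_less_trans)
  qed
qed

context gaussian_field
begin

lemma outer_prob_excursion_ge_of_least_variance:
  assumes K: "compact K" "K \<subseteq> T" "K \<noteq> {}" and q: "0 < q'" "q' < q" and m: "1 / q' \<le> least_variance M X K"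
  shows "\<forall>\<^sub>F u in at_top. exp (- q * u\<^sup>2 / 2) \<le> outer_prob M (excursion M X {K} u)"
proof -
  obtain B where B: "\<forall>t\<in>K. second_moment M (X t) \<le> B"
    using K(1,2) by (rule second_moment_bounded)
  have "0 < 1 / q'" using q by simp
  then have m_pos: "0 < least_variance M X K" using m by linarith
  have "1 / least_variance M X K < q"
  proof -
    have "1 / least_variance M X K \<le> q'" using m m_pos q(1) by (simp add: field_simps)
    then show ?thesis using q(2) by simp
  qed
  with m_pos obtain H where H: "lin_comb X K H" "\<forall>t\<in>K. 1 < w_H M X H t" "second_moment M H < q"
    by (rule admissible_lin_comb_obtains[OF K(2,3) B])
  have "lin_comb X T H" using H(1) K(2) by (rule lin_comb_mono)
  then show ?thesis
    using H(2,3) by (intro outer_prob_excursion_ge[OF K, of H]) (simp_all add: less_imp_le)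
qed

lemma least_variance_le_of_admissible_bound:
  assumes K: "compact K" "K \<subseteq> T" "K \<noteq> {}" and c: "0 < c"
    and bound: "\<And>H. lin_comb X K H \<Longrightarrow> \<forall>t\<in>K. 1 < w_H M X H t \<Longrightarrow> c \<le> second_moment M H"
  shows "least_variance M X K \<le> 1 / c"
proof (rule ccontr)
  assume "\<not> least_variance M X K \<le> 1 / c"
  then have "1 / c < least_variance M X K" by simp
  moreover from this have "0 < least_variance M X K"
    using c by (meson less_trans zero_less_divide_1_iff)
  ultimately have m: "0 < least_variance M X K" "1 / least_variance M X K < c"
    using c by (simp_all add: field_simps)
  obtain B where B: "\<forall>t\<in>K. second_moment M (X t) \<le> B"
    using K(1,2) by (rule second_moment_bounded)
  obtain H where "lin_comb X K H" "\<forall>t\<in>K. 1 < w_H M X H t" "second_moment M H < c"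
    by (rule admissible_lin_comb_obtains[OF K(2,3) B m])
  then show False using bound[of H] by simp
qed

theorem excursion_rate:
  fixes C :: ereal
  assumes C: "0 \<le> C" and \<K>: "\<And>K. K \<in> \<K> \<Longrightarrow> compact K \<and> K \<subseteq> T \<and> K \<noteq> {}"
    and upper: "\<And>c. 0 < c \<Longrightarrow> ereal c < C \<Longrightarrow>
      \<exists>S. compact S \<and> S \<subseteq> T \<and> (\<forall>K\<in>\<K>. K \<inter> S \<noteq> {} \<and> least_variance M X (K \<inter> S) \<le> 1 / c)"
    and lower: "\<And>q. C < ereal q \<Longrightarrow> \<exists>K\<in>\<K>. 1 / q \<le> least_variance M X K"
  shows "((\<lambda>u. eln (outer_prob M (excursion M X \<K> u)) / ereal (u\<^sup>2)) \<longlongrightarrow> - C / 2) at_top"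
proof (rule eln_rate_tendsto[OF C])
  show "outer_prob M (excursion M X \<K> u) \<le> 1" for u
    using outer_prob_le[OF excursion_subset_space sets.top, of M X \<K> u] by (simp add: prob_space)
next
  fix c assume c: "0 < c" "ereal c < C"
  then obtain c' where c': "c < c'" "ereal c' < C" using ereal_dense2 by force
  then have "0 < c'" using c by simp
  from upper[OF this c'(2)] obtain S where S: "compact S" "S \<subseteq> T"
    "\<forall>K\<in>\<K>. K \<inter> S \<noteq> {} \<and> least_variance M X (K \<inter> S) \<le> 1 / c'" by blast
  show "\<forall>\<^sub>F u in at_top. outer_prob M (excursion M X \<K> u) \<le> exp (- c * u\<^sup>2 / 2)"
    by (rule outer_prob_excursion_le[OF S(1,2), where v = "1 / c'"]) (use S(3) c c' \<open>0 < c'\<close> in auto)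
next
  fix q assume "C < ereal q"
  then obtain q' where q': "C < ereal q'" "q' < q" using ereal_dense2 by force
  have "0 < ereal q'" using C q'(1) by (rule le_less_trans)
  then have "0 < q'" by simp
  obtain K where K: "K \<in> \<K>" "1 / q' \<le> least_variance M X K" using lower[OF q'(1)] by blast
  then have "\<forall>\<^sub>F u in at_top. exp (- q * u\<^sup>2 / 2) \<le> outer_prob M (excursion M X {K} u)"
    using \<K>[OF K(1)] \<open>0 < q'\<close> q'(2) by (intro outer_prob_excursion_ge_of_least_variance) auto
  then show "\<forall>\<^sub>F u in at_top. exp (- q * u\<^sup>2 / 2) \<le> outer_prob M (excursion M X \<K> u)"
  proof eventually_elim
    case (elim u)
    have "outer_prob M (excursion M X {K} u) \<le> outer_prob M (excursion M X \<K> u)"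
      using K(1) by (intro outer_prob_mono excursion_subset_space excursion_mono) auto
    with elim show ?case by simp
  qed
qed

end

section \<open>Excursions along paths\<close>

definition path_images :: "'d::euclidean_space \<Rightarrow> 'd \<Rightarrow> 'd set \<Rightarrow> 'd set set" where
  "path_images a b T = (\<lambda>\<xi>. \<xi> ` {0..1}) ` {\<xi> \<in> paths_from_to a b. \<xi> ` {0..1} \<subseteq> T}"

lemma path_images_witness:
  "(\<exists>K\<in>path_images a b T. \<forall>t\<in>K. Q t) \<longleftrightarrow> (\<exists>\<xi>\<in>paths_from_to a b. \<forall>v\<in>{0..1}. \<xi> v \<in> T \<and> Q (\<xi> v))"
proof -
  have "(\<exists>K\<in>path_images a b T. \<forall>t\<in>K. Q t) \<longleftrightarrow>
      (\<exists>\<xi>\<in>{\<xi> \<in> paths_from_to a b. \<xi> ` {0..1} \<subseteq> T}. \<forall>t\<in>\<xi> ` {0..1}. Q t)"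
    by (simp add: path_images_def)
  also have "\<dots> \<longleftrightarrow> (\<exists>\<xi>\<in>paths_from_to a b. \<forall>v\<in>{0..1}. \<xi> v \<in> T \<and> Q (\<xi> v))"
    by (simp add: Bex_def image_subset_iff ball_conj_distrib conj_assoc)
  finally show ?thesis .
qed

lemma path_imagesD:
  assumes "K \<in> path_images a b T"
  shows "compact K" "connected K" "K \<subseteq> T" "a \<in> K" "K \<noteq> {}"
proof -
  obtain \<xi> where "\<xi> \<in> paths_from_to a b" and K: "K = \<xi> ` {0..1}" "K \<subseteq> T"
    using assms by (auto simp: path_images_def)
  then have \<xi>: "continuous_on {0..1} \<xi>" "\<xi> 0 = a"
    by (simp_all add: paths_from_to_def)
  show "compact K"
    unfolding K(1) using \<xi>(1) by (rule compact_continuous_image) simp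
  show "connected K"
    unfolding K(1) using \<xi>(1) by (rule connected_continuous_image) simp
  show "K \<subseteq> T" by fact
  show "a \<in> K"
    unfolding K(1) using \<xi>(2) by (intro image_eqI[of _ _ 0]) simp_all
  then show "K \<noteq> {}" by blast
qed

lemma Psi_ab_eq_excursion: "Psi_ab M X T a b u = outer_prob M (excursion M X (path_images a b T) u)"
  unfolding Psi_ab_def excursion_def path_images_witness ..

lemma Psi_a_eq_excursion: "Psi_a M X a u = outer_prob M (excursion M X (path_images 0 a UNIV) u)"
  unfolding Psi_a_def excursion_def path_images_witness by simp

lemma C_ab_le:
  assumes "in_L M X T H" "K \<in> path_images a b T" "\<forall>t\<in>K. 1 < w_H M X H t"
  shows "C_ab M X T a b \<le> ereal (second_moment M H)"
  unfolding C_ab_def using assms path_images_witness[of a b T "\<lambda>t. 1 < w_H M X H t"]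
  by (intro Inf_lower) blast

lemma C_ab_less_obtains:
  assumes "C_ab M X T a b < ereal q"
  obtains H K where "in_L M X T H" "K \<in> path_images a b T" "\<forall>t\<in>K. 1 < w_H M X H t"
    "second_moment M H < q"
proof -
  obtain H where "in_L M X T H" "second_moment M H < q" "\<exists>K\<in>path_images a b T. \<forall>t\<in>K. 1 < w_H M X H t"
    using assms unfolding C_ab_def Inf_less_iff path_images_witness by fastforce
  then show thesis using that by blast
qed

lemma (in gaussian_family) lin_comb_in_L:
  assumes "lin_comb X T H"
  shows "in_L M X T H"
  using lin_comb_square_integrable[OF assms] assms
  by (auto simp: in_L_def square_integrable_real_iff intro!: exI[of _ "\<lambda>_. H"])

lemma (in gaussian_family) least_variance_ge_of_admissible:
  assumes K: "K \<subseteq> T" "K \<noteq> {}" and H: "in_L M X T H" "second_moment M H \<le> q"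
    and w: "\<And>t. t \<in> K \<Longrightarrow> 1 < w_H M X H t"
  shows "1 / q \<le> least_variance M X K"
proof (rule least_variance_ge_of_dual[where \<phi> = X and N = M and h = H])
  show "square_integrable M (X t)" if "t \<in> K" for t
    using that K(1) by (intro point_square_integrable) auto
  then show "square_integrable M (X t)" if "t \<in> K" for t
    using that .
  show "1 \<le> (\<integral>x. X t x \<bullet> H x \<partial>M)" if "t \<in> K" for t
    using w[OF that] by (simp add: w_H_def)
  show "square_integrable M H"
    using H(1) by (simp add: in_L_def square_integrable_real_iff)
qed (use K(2) H(2) in auto)

lemma least_variance_le_of_less_C_ab:
  fixes X :: "'d::euclidean_space \<Rightarrow> 'a \<Rightarrow> real"
  assumes "gaussian_field M X T" and c: "0 < c" "ereal c < C_ab M X T a b"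
    and K: "K \<in> path_images a b T"
  shows "least_variance M X K \<le> 1 / c"
proof -
  interpret gaussian_field M X T by fact
  show ?thesis
  proof (rule least_variance_le_of_admissible_bound)
    fix H assume H: "lin_comb X K H" "\<forall>t\<in>K. 1 < w_H M X H t"
    have "in_L M X T H"
      using lin_comb_mono[OF H(1) path_imagesD(3)[OF K]] by (rule lin_comb_in_L)
    then have "C_ab M X T a b \<le> ereal (second_moment M H)"
      using K H(2) by (rule C_ab_le)
    with c(2) have "ereal c < ereal (second_moment M H)" by (rule less_le_trans)
    then show "c \<le> second_moment M H" by simp
  qed (use path_imagesD[OF K] c(1) in auto)
qed

theorem path_excursion_rate_compact:
  fixes X :: "'d::euclidean_space \<Rightarrow> 'a \<Rightarrow> real"
  assumes "gaussian_field M X T" and T: "compact T"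
  shows "((\<lambda>u. eln (Psi_ab M X T a b u) / ereal (u\<^sup>2)) \<longlongrightarrow> - C_ab M X T a b / 2) at_top"
  unfolding Psi_ab_eq_excursion
proof -
  interpret gaussian_field M X T by fact
  show "((\<lambda>u. eln (outer_prob M (excursion M X (path_images a b T) u)) / ereal (u\<^sup>2))
    \<longlongrightarrow> - C_ab M X T a b / 2) at_top"
  proof (rule excursion_rate)
    show "0 \<le> C_ab M X T a b" unfolding C_ab_def by (rule Inf_greatest) auto
    show "compact K \<and> K \<subseteq> T \<and> K \<noteq> {}" if "K \<in> path_images a b T" for K
      using path_imagesD[OF that] by blast
  next
    fix c assume c: "0 < c" "ereal c < C_ab M X T a b"
    have "K \<inter> T = K" "K \<noteq> {}" if "K \<in> path_images a b T" for K
      using path_imagesD[OF that] by auto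
    then show "\<exists>S. compact S \<and> S \<subseteq> T \<and>
        (\<forall>K\<in>path_images a b T. K \<inter> S \<noteq> {} \<and> least_variance M X (K \<inter> S) \<le> 1 / c)"
      using T least_variance_le_of_less_C_ab[OF assms(1) c] by (intro exI[of _ T]) simp
  next
    fix q assume "C_ab M X T a b < ereal q"
    then obtain H K where "in_L M X T H" and K: "K \<in> path_images a b T"
      and "\<forall>t\<in>K. 1 < w_H M X H t" "second_moment M H < q"
      by (rule C_ab_less_obtains)
    then have "1 / q \<le> least_variance M X K"
      by (intro least_variance_ge_of_admissible[OF path_imagesD(3,5)[OF K], of H]) simp_all
    with K show "\<exists>K\<in>path_images a b T. 1 / q \<le> least_variance M X K" by blast
  qed
qed

section \<open>Stationary fields\<close>

lemma C_a_le:
  assumes h: "h \<in> H_F F" and K: "K \<in> path_images 0 a UNIV"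
    and "\<forall>t\<in>K. Im (\<integral>x. cis (t \<bullet> x) * cnj (h x) \<partial>F) = 0 \<and> 1 < Re (\<integral>x. cis (t \<bullet> x) * cnj (h x) \<partial>F)"
  shows "C_a F a \<le> ereal (\<integral>x. (cmod (h x))\<^sup>2 \<partial>F)"
proof -
  have "\<exists>\<xi>\<in>paths_from_to 0 a. \<forall>v\<in>{0..1}. Im (\<integral>x. cis (\<xi> v \<bullet> x) * cnj (h x) \<partial>F) = 0 \<and>
      1 < Re (\<integral>x. cis (\<xi> v \<bullet> x) * cnj (h x) \<partial>F)"
    using path_images_witness[of 0 a UNIV "\<lambda>t. Im (\<integral>x. cis (t \<bullet> x) * cnj (h x) \<partial>F) = 0 \<and>
      1 < Re (\<integral>x. cis (t \<bullet> x) * cnj (h x) \<partial>F)"] K assms(3) by blast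
  with h show ?thesis
    unfolding C_a_def by (intro Inf_lower) blast
qed

lemma C_a_less_obtains:
  assumes "C_a F a < ereal q"
  obtains h K where "h \<in> H_F F" "K \<in> path_images 0 a UNIV"
    "\<forall>t\<in>K. 1 < Re (\<integral>x. cis (t \<bullet> x) * cnj (h x) \<partial>F)" "(\<integral>x. (cmod (h x))\<^sup>2 \<partial>F) < q"
proof -
  obtain h \<xi> where h: "h \<in> H_F F" "(\<integral>x. (cmod (h x))\<^sup>2 \<partial>F) < q" and \<xi>: "\<xi> \<in> paths_from_to 0 a"
    "\<forall>v\<in>{0..1}. 1 < Re (\<integral>x. cis (\<xi> v \<bullet> x) * cnj (h x) \<partial>F)"
    using assms unfolding C_a_def Inf_less_iff by auto
  have "\<xi> ` {0..1} \<in> path_images 0 a UNIV"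
    using \<xi>(1) by (simp add: path_images_def)
  then show thesis
    using \<xi>(2) by (intro that[OF h(1) _ _ h(2)]) auto
qed

lemma connected_norm_attained:
  fixes K :: "'d::real_normed_vector set"
  assumes "connected K" "0 \<in> K" "x \<in> K" "0 \<le> r" "r \<le> norm x"
  shows "\<exists>t\<in>K. norm t = r"
proof -
  have "connected (norm ` K)"
    using assms(1) by (intro connected_continuous_image continuous_intros)
  then have "{norm (0::'d)..norm x} \<subseteq> norm ` K"
    using assms(2,3) by (intro connected_contains_Icc) auto
  then show ?thesis using assms(4,5) by auto
qed

locale stationary_gaussian_field = gaussian_field M X UNIV
  for M :: "'a measure" and X :: "'d::euclidean_space \<Rightarrow> 'a \<Rightarrow> real" +
  fixes F :: "'d measure"
  assumes stationary: "stationary_cov M X" and spectral: "spectral_measure_of M X F"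
begin

sublocale F: finite_measure F
  using spectral by (simp add: spectral_measure_of_def)

lemma sets_F[measurable_cong]: "sets F = sets borel"
  using spectral by (simp add: spectral_measure_of_def)

lemma integral_mult_eq_cov: "(\<integral>x. X s x * X t x \<partial>M) = cov_fun M X (s - t)"
  using stationary unfolding stationary_cov_def by (subst mult.commute) simp

lemma second_moment_eq_cov: "second_moment M (X t) = cov_fun M X 0"
  using integral_mult_eq_cov[of t t] by (simp add: power2_eq_square)

lemma borel_measurable_character[measurable]: "(\<lambda>x. cis (t \<bullet> x)) \<in> borel_measurable F"
proof -
  have "(\<lambda>x. cis (t \<bullet> x)) \<in> borel_measurable borel"
    unfolding cis_conv_exp by (intro borel_measurable_continuous_onI continuous_intros)
  then show ?thesis by measurable
qed

lemma integrable_character: "integrable F (\<lambda>x. cis (t \<bullet> x))"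
  by (rule F.integrable_const_bound[where B = 1]) auto

lemma integral_character: "(\<integral>x. cis (t \<bullet> x) \<partial>F) = of_real (cov_fun M X t)"
  using spectral by (simp add: spectral_measure_of_def)

lemma character_mult_cnj: "cis (s \<bullet> x) * cnj (cis (t \<bullet> x)) = cis ((s - t) \<bullet> x)" for s t x :: 'd
  by (simp add: inner_diff_left cis_cnj cis_mult)

lemma character_square_integrable: "square_integrable F (\<lambda>x. cis (t \<bullet> x))"
  by (simp add: square_integrable_def)

lemma character_gram: "(\<integral>x. cis (s \<bullet> x) \<bullet> cis (t \<bullet> x) \<partial>F) = (\<integral>x. X s x * X t x \<partial>M)"
proof -
  have "(\<integral>x. cis (s \<bullet> x) \<bullet> cis (t \<bullet> x) \<partial>F) = (\<integral>x. Re (cis ((s - t) \<bullet> x)) \<partial>F)"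
    by (simp add: inner_complex_def inner_diff_left cos_diff)
  also have "\<dots> = Re (\<integral>x. cis ((s - t) \<bullet> x) \<partial>F)"
    by (rule integral_Re[OF integrable_character])
  finally show ?thesis by (simp add: integral_character integral_mult_eq_cov)
qed

lemma spectral_representation_obtains:
  assumes "lin_comb X K Y"
  obtains h where "h \<in> H_F F" "(\<integral>x. (cmod (h x))\<^sup>2 \<partial>F) = second_moment M Y"
    "\<forall>s. (\<integral>x. cis (s \<bullet> x) * cnj (h x) \<partial>F) = of_real (w_H M X Y s)"
proof -
  obtain n :: nat and c t where Y: "Y = (\<lambda>x. \<Sum>i<n. c i * X (t i) x)"
    using assms unfolding lin_comb_def by blast
  define h where "h = (\<lambda>x. \<Sum>i<n. c i *\<^sub>R cis (t i \<bullet> x))"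
  have "square_integrable F h"
    unfolding h_def by (intro square_integrable_sum_scaleR character_square_integrable)
  then have "h \<in> H_F F"
    by (simp add: H_F_def square_integrable_def) (simp add: h_def sum_negf)
  moreover have "(\<integral>x. (cmod (h x))\<^sup>2 \<partial>F) = second_moment M Y"
    using integral_norm_sum_square[of "{..<n}" F "\<lambda>i x. cis (t i \<bullet> x)" c]
      integral_norm_sum_square[of "{..<n}" M "\<lambda>i. X (t i)" c]
    by (simp add: h_def Y character_square_integrable point_square_integrable character_gram)
  moreover have "(\<integral>x. cis (s \<bullet> x) * cnj (h x) \<partial>F) = of_real (w_H M X Y s)" for s
  proof -
    have "cis (s \<bullet> x) * cnj (h x) = (\<Sum>i<n. c i *\<^sub>R cis ((s - t i) \<bullet> x))" for x
      by (simp add: h_def sum_distrib_left flip: character_mult_cnj)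
    then have "(\<integral>x. cis (s \<bullet> x) * cnj (h x) \<partial>F) = of_real (\<Sum>i<n. c i * cov_fun M X (s - t i))"
      by (simp add: integrable_character integral_character scaleR_conv_of_real)
    also have "(\<Sum>i<n. c i * cov_fun M X (s - t i)) = (\<integral>x. (\<Sum>i<n. c i * (X s x * X (t i) x)) \<partial>M)"
      by (simp add: lin_comb_mult_integrable lin_comb_point integral_mult_eq_cov)
    also have "\<dots> = w_H M X Y s"
      by (simp add: w_H_def Y sum_distrib_left mult.left_commute)
    finally show ?thesis .
  qed
  ultimately show thesis using that by blast
qed

lemma least_variance_ge_of_spectral:
  assumes K: "K \<noteq> {}" and h: "h \<in> H_F F" "(\<integral>x. (cmod (h x))\<^sup>2 \<partial>F) \<le> q"
    and w: "\<And>t. t \<in> K \<Longrightarrow> 1 < Re (\<integral>x. cis (t \<bullet> x) * cnj (h x) \<partial>F)"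
  shows "1 / q \<le> least_variance M X K"
proof (rule least_variance_ge_of_dual[where \<phi> = "\<lambda>t x. cis (t \<bullet> x)" and N = F and h = h])
  show "square_integrable F h" using h(1) by (simp add: H_F_def square_integrable_def)
  fix t assume "t \<in> K"
  have "integrable F (\<lambda>x. cis (t \<bullet> x) * cnj (h x))"
    using w[OF \<open>t \<in> K\<close>] not_integrable_integral_eq[of F "\<lambda>x. cis (t \<bullet> x) * cnj (h x)"] by force
  then have "Re (\<integral>x. cis (t \<bullet> x) * cnj (h x) \<partial>F) = (\<integral>x. cis (t \<bullet> x) \<bullet> h x \<partial>F)"
    by (simp add: integral_Re[symmetric] inner_complex_def)
  then show "1 \<le> (\<integral>x. cis (t \<bullet> x) \<bullet> h x \<partial>F)" using w[OF \<open>t \<in> K\<close>] by simp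
qed (use K h(2) point_square_integrable character_square_integrable character_gram in simp_all)

lemma least_variance_equispaced_norms:
  assumes n: "0 < n" and t: "\<And>i. i < n \<Longrightarrow> t i \<in> K" "\<And>i. i < n \<Longrightarrow> norm (t i) = real i * \<rho>"
    and \<rho>: "0 < \<rho>" and \<epsilon>: "0 \<le> \<epsilon>" and cov: "\<And>r. \<rho> \<le> norm r \<Longrightarrow> cov_fun M X r \<le> \<epsilon>"
  shows "least_variance M X K \<le> cov_fun M X 0 / n + \<epsilon>"
proof -
  have separated: "\<rho> \<le> norm (t i - t j)" if "i < n" "j < n" "i \<noteq> j" for i j
  proof -
    have "1 * \<rho> \<le> \<bar>real i - real j\<bar> * \<rho>" using that(3) \<rho> by (intro mult_right_mono) auto
    also have "\<dots> = \<bar>norm (t i) - norm (t j)\<bar>"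
      using t(2) that(1,2) \<rho> by (simp add: left_diff_distrib[symmetric] abs_mult)
    also have "\<dots> \<le> norm (t i - t j)" by (rule norm_triangle_ineq3)
    finally show ?thesis by simp
  qed
  have "inj_on t {..<n}"
    using separated \<rho> by (fastforce simp: inj_on_def)
  then have card: "card (t ` {..<n}) = n" by (simp add: card_image)
  have "least_variance M X K \<le> cov_fun M X 0 / card (t ` {..<n}) + \<epsilon>"
  proof (rule least_variance_separated)
    fix r s assume "r \<in> t ` {..<n}" "s \<in> t ` {..<n}" "r \<noteq> s"
    then have "\<rho> \<le> norm (r - s)" using separated by auto
    then show "(\<integral>x. X r x * X s x \<partial>M) \<le> \<epsilon>" using cov by (simp add: integral_mult_eq_cov)
  qed (use n t(1) \<epsilon> in \<open>auto simp: second_moment_eq_cov point_square_integrable\<close>)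
  then show ?thesis by (simp add: card)
qed

lemma least_variance_escaping_obtains:
  assumes lim: "Limsup at_infinity (\<lambda>t. ereal (cov_fun M X t)) \<le> 0" and \<epsilon>: "0 < \<epsilon>"
  obtains R where "0 < R"
    "\<And>K. connected K \<Longrightarrow> 0 \<in> K \<Longrightarrow> \<not> K \<subseteq> cball 0 R \<Longrightarrow> least_variance M X (K \<inter> cball 0 R) \<le> \<epsilon>"
proof -
  have "Limsup at_infinity (\<lambda>t. ereal (cov_fun M X t)) < ereal (\<epsilon> / 2)"
    using lim \<epsilon> by (simp add: le_less_trans)
  then have "\<forall>\<^sub>F t in at_infinity. ereal (cov_fun M X t) < ereal (\<epsilon> / 2)" by (rule Limsup_lessD)
  then obtain b where "\<And>t. b \<le> norm t \<Longrightarrow> cov_fun M X t < \<epsilon> / 2" by (auto simp: eventually_at_infinity)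
  then have cov: "cov_fun M X t \<le> \<epsilon> / 2" if "max 1 b \<le> norm t" for t
    using that by (simp add: less_imp_le)
  define \<rho> where "\<rho> = max 1 b"
  have \<rho>: "0 < \<rho>" by (simp add: \<rho>_def)
  obtain m :: nat where "2 * cov_fun M X 0 / \<epsilon> \<le> real m" using real_arch_simple by blast
  then have m: "cov_fun M X 0 / Suc m \<le> \<epsilon> / 2"
    using \<epsilon> by (simp add: field_simps)
  define R where "R = real (Suc m) * \<rho>"
  show thesis
  proof (rule that)
    show "0 < R" using \<rho> by (simp add: R_def)
    fix K :: "'d set" assume K: "connected K" "0 \<in> K" "\<not> K \<subseteq> cball 0 R"
    then obtain x where x: "x \<in> K" "R < norm x" by (auto simp: subset_eq not_le)
    have "\<exists>t\<in>K \<inter> cball 0 R. norm t = real i * \<rho>" if "i < Suc m" for i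
    proof -
      have "real i * \<rho> \<le> R" using that \<rho> unfolding R_def by (intro mult_right_mono) auto
      moreover from this have "\<exists>t\<in>K. norm t = real i * \<rho>"
        using x \<rho> by (intro connected_norm_attained[OF K(1,2)]) auto
      ultimately show ?thesis by auto
    qed
    then obtain t where "\<And>i. i < Suc m \<Longrightarrow> t i \<in> K \<inter> cball 0 R" "\<And>i. i < Suc m \<Longrightarrow> norm (t i) = real i * \<rho>"
      by metis
    then have "least_variance M X (K \<inter> cball 0 R) \<le> cov_fun M X 0 / Suc m + \<epsilon> / 2"
      using \<rho> \<epsilon> cov by (intro least_variance_equispaced_norms) (auto simp: \<rho>_def)
    then show "least_variance M X (K \<inter> cball 0 R) \<le> \<epsilon>" using m by linarith
  qed
qed

lemma least_variance_le_of_less_C_a: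
  assumes c: "0 < c" "ereal c < C_a F a" and K: "K \<in> path_images 0 a UNIV"
  shows "least_variance M X K \<le> 1 / c"
proof (rule least_variance_le_of_admissible_bound)
  fix H assume H: "lin_comb X K H" "\<forall>t\<in>K. 1 < w_H M X H t"
  obtain h where h: "h \<in> H_F F" "(\<integral>x. (cmod (h x))\<^sup>2 \<partial>F) = second_moment M H"
    "\<forall>s. (\<integral>x. cis (s \<bullet> x) * cnj (h x) \<partial>F) = of_real (w_H M X H s)"
    using H(1) by (rule spectral_representation_obtains)
  have "C_a F a \<le> ereal (\<integral>x. (cmod (h x))\<^sup>2 \<partial>F)"
    using h(3) H(2) by (intro C_a_le[OF h(1) K]) simp
  with c(2) have "ereal c < ereal (second_moment M H)" unfolding h(2) by (rule less_le_trans)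
  then show "c \<le> second_moment M H" by simp
qed (use path_imagesD[OF K] c(1) in auto)

theorem path_excursion_rate_stationary:
  assumes lim: "Limsup at_infinity (\<lambda>t. ereal (cov_fun M X t)) \<le> 0"
  shows "((\<lambda>u. eln (Psi_a M X a u) / ereal (u\<^sup>2)) \<longlongrightarrow> - C_a F a / 2) at_top"
  unfolding Psi_a_eq_excursion
proof (rule excursion_rate)
  show "0 \<le> C_a F a" unfolding C_a_def by (rule Inf_greatest) auto
  show "compact K \<and> K \<subseteq> UNIV \<and> K \<noteq> {}" if "K \<in> path_images 0 a UNIV" for K
    using path_imagesD[OF that] by blast
next
  fix c assume c: "0 < c" "ereal c < C_a F a"
  then have "0 < 1 / c" by simp
  then obtain R where R: "0 < R" "\<And>K. connected K \<Longrightarrow> 0 \<in> K \<Longrightarrow> \<not> K \<subseteq> cball 0 R \<Longrightarrow>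
      least_variance M X (K \<inter> cball 0 R) \<le> 1 / c"
    using least_variance_escaping_obtains[OF lim] by metis
  have "K \<inter> cball 0 R \<noteq> {} \<and> least_variance M X (K \<inter> cball 0 R) \<le> 1 / c"
    if K: "K \<in> path_images 0 a UNIV" for K
  proof
    show "K \<inter> cball 0 R \<noteq> {}" using path_imagesD(4)[OF K] R(1) by auto
    show "least_variance M X (K \<inter> cball 0 R) \<le> 1 / c"
    proof (cases "K \<subseteq> cball 0 R")
      case True
      then show ?thesis using least_variance_le_of_less_C_a[OF c K] by (simp add: Int_absorb2)
    qed (use path_imagesD[OF K] R(2) in auto)
  qed
  then show "\<exists>S. compact S \<and> S \<subseteq> UNIV \<and>
      (\<forall>K\<in>path_images 0 a UNIV. K \<inter> S \<noteq> {} \<and> least_variance M X (K \<inter> S) \<le> 1 / c)"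
    by (intro exI[of _ "cball 0 R"]) simp
next
  fix q assume "C_a F a < ereal q"
  then obtain h K where "h \<in> H_F F" and K: "K \<in> path_images 0 a UNIV"
    and "\<forall>t\<in>K. 1 < Re (\<integral>x. cis (t \<bullet> x) * cnj (h x) \<partial>F)" "(\<integral>x. (cmod (h x))\<^sup>2 \<partial>F) < q"
    by (rule C_a_less_obtains)
  then have "1 / q \<le> least_variance M X K"
    by (intro least_variance_ge_of_spectral[OF path_imagesD(5)[OF K], of h]) simp_all
  with K show "\<exists>K\<in>path_images 0 a UNIV. 1 / q \<le> least_variance M X K" by blast
qed

end

lemma gaussian_fieldI:
  assumes "prob_space M" "centered_gaussian_field M X T" "continuous_paths M X T"
  shows "gaussian_field M X T"
  using assms
  by (simp add: gaussian_field_def gaussian_field_axioms_def gaussian_family_def gaussian_family_axioms_def)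

theorem theorem3p1:
  shows
  "(\<forall>(M::'a measure) (X::'d::euclidean_space \<Rightarrow> 'a \<Rightarrow> real) T a b.
      prob_space M \<and> compact T \<and> centered_gaussian_field M X T \<and>
      continuous_paths M X T \<and> a \<in> T \<and> b \<in> T \<and> a \<noteq> b \<and>
      (\<exists>\<xi>\<in>paths_from_to a b. \<forall>v\<in>{0..1}. \<xi> v \<in> T)
      \<longrightarrow> ((\<lambda>u. eln (Psi_ab M X T a b u) / ereal (u\<^sup>2)) \<longlongrightarrow> - C_ab M X T a b / 2) at_top)
   \<and>
   (\<forall>(M::'a measure) (X::'d \<Rightarrow> 'a \<Rightarrow> real) F a.
      prob_space M \<and> centered_gaussian_field M X UNIV \<and>
      continuous_paths M X UNIV \<and> stationary_cov M X \<and>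
      spectral_measure_of M X F \<and>
      Limsup at_infinity (\<lambda>t. ereal (cov_fun M X t)) \<le> 0 \<and> a \<noteq> 0
      \<longrightarrow> ((\<lambda>u. eln (Psi_a M X a u) / ereal (u\<^sup>2)) \<longlongrightarrow> - C_a F a / 2) at_top)"
proof (intro conjI allI impI; elim conjE)
  fix M :: "'a measure" and X :: "'d \<Rightarrow> 'a \<Rightarrow> real" and T a b
  assume "prob_space M" "centered_gaussian_field M X T" "continuous_paths M X T" "compact T"
  then show "((\<lambda>u. eln (Psi_ab M X T a b u) / ereal (u\<^sup>2)) \<longlongrightarrow> - C_ab M X T a b / 2) at_top"
    by (intro path_excursion_rate_compact gaussian_fieldI)
next
  fix M :: "'a measure" and X :: "'d \<Rightarrow> 'a \<Rightarrow> real" and F a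
  assume X: "prob_space M" "centered_gaussian_field M X UNIV" "continuous_paths M X UNIV"
    and F: "stationary_cov M X" "spectral_measure_of M X F"
    and lim: "Limsup at_infinity (\<lambda>t. ereal (cov_fun M X t)) \<le> 0"
  interpret gaussian_field M X UNIV using X by (rule gaussian_fieldI)
  interpret stationary_gaussian_field M X F by standard (fact F)+
  show "((\<lambda>u. eln (Psi_a M X a u) / ereal (u\<^sup>2)) \<longlongrightarrow> - C_a F a / 2) at_top"
    using lim by (rule path_excursion_rate_stationary)
qed

end
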